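(* Let $R:(\mathcal C\times\mathcal C)^{op}\to\mathbf{Pos}$ be an extensional relational doctrine with quotients and $\mathcal G$ a full subcategory of $\mathcal C$. Then the following are equivalent: (1) $\mathcal G$ is an $R$-projective cover. (2) For every monad $\mathbb T=(T,\eta,\mu)$ on $R$ in $\mathbf{EQRD}$, $\mathcal G_{\widehat{\mathbb T}}$ is an $R^{\mathbb T}$-projective cover.
   Context: $\mathbf{Pos}$ is the category of posets and monotone maps. A relational doctrine consists of a category $\mathcal C$ (its base); a functor $R:(\mathcal C\times\mathcal C)^{op}\to\mathbf{Pos}$ (for $f:X\to A$, $g:Y\to B$ write $R_{f,g}:R(A,B)\to R(X,Y)$); elements $d_X\in R(X,X)$ with $d_X\le R_{f,f}(d_Y)$ for all $f:X\to Y$; monotone maps $;:R(X,Y)\times R(Y,Z)\to R(X,Z)$ with $R_{f,g}(\alpha);R_{g,h}(\beta)\le R_{f,h}(\alpha;\beta)$; monotone maps $(-)^\bot:R(X,Y)\to R(Y,X)$ with $(R_{f,g}(\alpha))^\bot\le R_{g,f}(\alpha^\bot)$; such that $;$ is associative with units $d$, $(\alpha;\beta)^\bot=\beta^\bot;\alpha^\bot$, $d_X^\bot=d_X$, $\alpha^{\bot\bot}=\alpha$. The graph of $f:X\to Y$ is $\Gamma_f=R_{f,\mathrm{id}_Y}(d_Y)\in R(X,Y)$. An $R$-equivalence relation on $X$ is $\rho\in R(X,X)$ with $d_X\le\rho$, $\rho^\bot\le\rho$, $\rho;\rho\le\rho$. A quotient arrow of $\rho$ is $q:X\to W$ with $\rho\le\Gamma_q;\Gamma_q^\bot$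 such that for every $f:X\to Z$ with $\rho\le\Gamma_f;\Gamma_f^\bot$ there is a unique $h:W\to Z$ with $f=h\circ q$. It is effective if $\rho=\Gamma_q;\Gamma_q^\bot$, and descent if $d_W\le\Gamma_q^\bot;\Gamma_q$. $R$ has quotients if every $R$-equivalence relation admits an effective descent quotient arrow. "A quotient arrow" means a quotient arrow of some $R$-equivalence relation. $R$ is extensional if, for parallel $f,g:X\to Y$, $d_X\le R_{f,g}(d_Y)$ implies $f=g$. The 2-category $\mathbf{EQRD}$: objects are extensional relational doctrines with quotients; a 1-arrow $F:R\to S$ (bases $\mathcal C,\mathcal D$) is a pair of a functor $\widehat F:\mathcal C\to\mathcal D$ and a natural transformation with components $\overline F_{X,Y}:R(X,Y)\to S(\widehat FX,\widehat FY)$ strictly preserving $d$, $;$ and $(-)^\bot$, and preserving quotient arrows (if $q$ is a quotient arrow of $\rho$ on $X$, then $\widehat Fq$ is a quotient arrow of $\overline F_{X,X}(\rho)$); a 2-arrow $\theta:F\Rightarrow G$ is a natural transformation $\theta:\widehat F\to\widehat G$ with $\overline F_{X,Y}(\alpha)\le S_{\theta_X,\theta_Y}(\overline G_{X,Y}(\alpha))$. A monad on $R$ in $\mathbf{EQRD}$ is a 1-arrow $T:R\to R$ with 2-arrows $\eta:\mathrm{Id}\Rightarrow T$, $\mu:T\circ T\Rightarrow T$ satisfying the usual monad laws; then $\widehat{\mathbb T}=(\widehat T,\eta,\mu)$ is a monad on $\mathcal C$. The Eilenberg–Moore doctrine $R^{\mathbb T}$ has as base the Eilenberg–Moore category $\mathcal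 C^{\widehat{\mathbb T}}$, and $R^{\mathbb T}((X,a),(Y,b))=\{\alpha\in R(X,Y)\mid\Gamma_a^\bot;\overline T_{X,Y}(\alpha);\Gamma_b\le\alpha\}$, with reindexing and relational operations as in $R$; it is an extensional relational doctrine with quotients. For a full subcategory $\mathcal G$ of $\mathcal C$, $\mathcal G_{\widehat{\mathbb T}}$ is the full subcategory of $\mathcal C^{\widehat{\mathbb T}}$ on the free algebras $(\widehat TX,\mu_X)$ with $X$ an object of $\mathcal G$. For $R$ with quotients, an object $P$ of the base is $R$-projective if for every arrow $f:P\to Y$ and every quotient arrow $q:X\to Y$ there is an arrow $h:P\to X$ with $f=q\circ h$. An $R$-projective cover is a full subcategory $\mathcal G$ of the base, all of whose objects are $R$-projective, such that for every object $X$ of the base there is a quotient arrow $q:P\to X$ with $P$ in $\mathcal G$. *)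

theory Defs
  imports Main
begin

section \<open>Categories, functors and natural transformations\<close>

text \<open>Every arrow determines its domain and codomain, so hom-sets are disjoint. Everything is
  relative to the carriers \<open>Obj\<close> and \<open>Arr\<close>; values outside of them are irrelevant.\<close>

record ('o, 'a) cat =
  Obj :: "'o set"
  Arr :: "'a set"
  Dom :: "'a \<Rightarrow> 'o"
  Cod :: "'a \<Rightarrow> 'o"
  Id :: "'o \<Rightarrow> 'a"
  Comp :: "'a \<Rightarrow> 'a \<Rightarrow> 'a"  (infixr "\<cdot>\<index>" 70)

definition Hom :: "('o, 'a) cat \<Rightarrow> 'o \<Rightarrow> 'o \<Rightarrow> 'a set" where
  "Hom C X Y = {f \<in> Arr C. Dom C f = X \<and> Cod C f = Y}"

locale category =
  fixes C :: "('o, 'a) cat" (structure)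
  assumes dom_obj: "f \<in> Arr C \<Longrightarrow> Dom C f \<in> Obj C"
    and cod_obj: "f \<in> Arr C \<Longrightarrow> Cod C f \<in> Obj C"
    and id_hom: "X \<in> Obj C \<Longrightarrow> Id C X \<in> Hom C X X"
    and comp_hom: "f \<in> Hom C X Y \<Longrightarrow> g \<in> Hom C Y Z \<Longrightarrow> g \<cdot> f \<in> Hom C X Z"
    and comp_id_right: "f \<in> Hom C X Y \<Longrightarrow> f \<cdot> Id C X = f"
    and comp_id_left: "f \<in> Hom C X Y \<Longrightarrow> Id C Y \<cdot> f = f"
    and comp_assoc: "f \<in> Hom C W X \<Longrightarrow> g \<in> Hom C X Y \<Longrightarrow> h \<in> Hom C Y Z \<Longrightarrow>
      (h \<cdot> g) \<cdot> f = h \<cdot> (g \<cdot> f)"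

definition full_subcategory :: "('o, 'a) cat \<Rightarrow> ('o, 'a) cat \<Rightarrow> bool" where
  "full_subcategory G C \<longleftrightarrow>
     Obj G \<subseteq> Obj C \<and>
     Arr G = {f \<in> Arr C. Dom C f \<in> Obj G \<and> Cod C f \<in> Obj G} \<and>
     (\<forall>f\<in>Arr G. Dom G f = Dom C f \<and> Cod G f = Cod C f) \<and>
     (\<forall>X\<in>Obj G. Id G X = Id C X) \<and>
     (\<forall>f\<in>Arr G. \<forall>g\<in>Arr G. Dom C g = Cod C f \<longrightarrow> g \<cdot>\<^bsub>G\<^esub> f = g \<cdot>\<^bsub>C\<^esub> f)"

definition full_subcategory_on :: "('o, 'a) cat \<Rightarrow> 'o set \<Rightarrow> ('o, 'a) cat" where
  "full_subcategory_on C S =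
     C\<lparr>Obj := S, Arr := {f \<in> Arr C. Dom C f \<in> S \<and> Cod C f \<in> S}\<rparr>"

record ('o, 'a, 'p, 'b) ftor =
  FObj :: "'o \<Rightarrow> 'p"
  FArr :: "'a \<Rightarrow> 'b"

locale cat_functor =
  fixes C :: "('o, 'a) cat" and D :: "('p, 'b) cat" and F :: "('o, 'a, 'p, 'b) ftor"
  assumes source: "category C"
    and target: "category D"
    and map_obj: "X \<in> Obj C \<Longrightarrow> FObj F X \<in> Obj D"
    and map_hom: "f \<in> Hom C X Y \<Longrightarrow> FArr F f \<in> Hom D (FObj F X) (FObj F Y)"
    and map_id: "X \<in> Obj C \<Longrightarrow> FArr F (Id C X) = Id D (FObj F X)"
    and map_comp: "f \<in> Hom C X Y \<Longrightarrow> g \<in> Hom C Y Z \<Longrightarrow>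
      FArr F (g \<cdot>\<^bsub>C\<^esub> f) = FArr F g \<cdot>\<^bsub>D\<^esub> FArr F f"

definition nat_trans ::
  "('o, 'a) cat \<Rightarrow> ('p, 'b) cat \<Rightarrow> ('o, 'a, 'p, 'b) ftor \<Rightarrow> ('o, 'a, 'p, 'b) ftor \<Rightarrow>
    ('o \<Rightarrow> 'b) \<Rightarrow> bool" where
  "nat_trans C D F G \<theta> \<longleftrightarrow>
     (\<forall>X\<in>Obj C. \<theta> X \<in> Hom D (FObj F X) (FObj G X)) \<and>
     (\<forall>X\<in>Obj C. \<forall>Y\<in>Obj C. \<forall>f\<in>Hom C X Y.
        \<theta> Y \<cdot>\<^bsub>D\<^esub> FArr F f = FArr G f \<cdot>\<^bsub>D\<^esub> \<theta> X)"


section \<open>Relational doctrines\<close>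

text \<open>\<open>Rel R X Y\<close> with the order \<open>Le R X Y\<close> is the poset $R(X,Y)$; all fibres live in one type,
  and different fibres may overlap. \<open>Reidx R f g\<close> is $R_{f,g}$, \<open>Diag R X\<close> is $d_X$,
  \<open>RComp R X Y Z \<alpha> \<beta>\<close> is $\alpha;\beta$ (diagrammatic order) and \<open>Conv R X Y \<alpha>\<close> is
  $\alpha^\bot$.\<close>

record ('o, 'a, 'r) doctrine =
  Base :: "('o, 'a) cat"
  Rel :: "'o \<Rightarrow> 'o \<Rightarrow> 'r set"
  Le :: "'o \<Rightarrow> 'o \<Rightarrow> 'r \<Rightarrow> 'r \<Rightarrow> bool"
  Reidx :: "'a \<Rightarrow> 'a \<Rightarrow> 'r \<Rightarrow> 'r"
  Diag :: "'o \<Rightarrow> 'r"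
  RComp :: "'o \<Rightarrow> 'o \<Rightarrow> 'o \<Rightarrow> 'r \<Rightarrow> 'r \<Rightarrow> 'r"
  Conv :: "'o \<Rightarrow> 'o \<Rightarrow> 'r \<Rightarrow> 'r"

text \<open>The assumptions from \<open>rel_refl\<close> to \<open>reidx_comp\<close> say that $R$ is a functor
  $(C \times C)^{op} \to \mathbf{Pos}$.\<close>

locale relational_doctrine =
  fixes R :: "('o, 'a, 'r) doctrine"
  assumes base: "category (Base R)"
    and rel_refl: "X \<in> Obj (Base R) \<Longrightarrow> Y \<in> Obj (Base R) \<Longrightarrow> reflp_on (Rel R X Y) (Le R X Y)"
    and rel_trans: "X \<in> Obj (Base R) \<Longrightarrow> Y \<in> Obj (Base R) \<Longrightarrow> transp_on (Rel R X Y) (Le R X Y)"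
    and rel_antisym:
      "X \<in> Obj (Base R) \<Longrightarrow> Y \<in> Obj (Base R) \<Longrightarrow> antisymp_on (Rel R X Y) (Le R X Y)"
    and reidx_closed: "f \<in> Hom (Base R) X A \<Longrightarrow> g \<in> Hom (Base R) Y B \<Longrightarrow>
      \<alpha> \<in> Rel R A B \<Longrightarrow> Reidx R f g \<alpha> \<in> Rel R X Y"
    and reidx_mono: "f \<in> Hom (Base R) X A \<Longrightarrow> g \<in> Hom (Base R) Y B \<Longrightarrow>
      monotone_on (Rel R A B) (Le R A B) (Le R X Y) (Reidx R f g)"
    and reidx_id: "X \<in> Obj (Base R) \<Longrightarrow> Y \<in> Obj (Base R) \<Longrightarrow> \<alpha> \<in> Rel R X Y \<Longrightarrow>
      Reidx R (Id (Base R) X) (Id (Base R) Y) \<alpha> = \<alpha>"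
    and reidx_comp: "f \<in> Hom (Base R) X A \<Longrightarrow> f' \<in> Hom (Base R) A A' \<Longrightarrow>
      g \<in> Hom (Base R) Y B \<Longrightarrow> g' \<in> Hom (Base R) B B' \<Longrightarrow> \<alpha> \<in> Rel R A' B' \<Longrightarrow>
      Reidx R (f' \<cdot>\<^bsub>Base R\<^esub> f) (g' \<cdot>\<^bsub>Base R\<^esub> g) \<alpha> = Reidx R f g (Reidx R f' g' \<alpha>)"
    and diag_closed: "X \<in> Obj (Base R) \<Longrightarrow> Diag R X \<in> Rel R X X"
    and diag_lax: "f \<in> Hom (Base R) X Y \<Longrightarrow> Le R X X (Diag R X) (Reidx R f f (Diag R Y))"
    and rcomp_closed: "X \<in> Obj (Base R) \<Longrightarrow> Y \<in> Obj (Base R) \<Longrightarrow> Z \<in> Obj (Base R) \<Longrightarrow>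
      \<alpha> \<in> Rel R X Y \<Longrightarrow> \<beta> \<in> Rel R Y Z \<Longrightarrow> RComp R X Y Z \<alpha> \<beta> \<in> Rel R X Z"
    and rcomp_mono: "X \<in> Obj (Base R) \<Longrightarrow> Y \<in> Obj (Base R) \<Longrightarrow> Z \<in> Obj (Base R) \<Longrightarrow>
      \<alpha> \<in> Rel R X Y \<Longrightarrow> \<alpha>' \<in> Rel R X Y \<Longrightarrow> \<beta> \<in> Rel R Y Z \<Longrightarrow> \<beta>' \<in> Rel R Y Z \<Longrightarrow>
      Le R X Y \<alpha> \<alpha>' \<Longrightarrow> Le R Y Z \<beta> \<beta>' \<Longrightarrow> Le R X Z (RComp R X Y Z \<alpha> \<beta>) (RComp R X Y Z \<alpha>' \<beta>')"
    and rcomp_lax: "f \<in> Hom (Base R) X A \<Longrightarrow> g \<in> Hom (Base R) Y B \<Longrightarrow> h \<in> Hom (Base R) Z C \<Longrightarrow>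
      \<alpha> \<in> Rel R A B \<Longrightarrow> \<beta> \<in> Rel R B C \<Longrightarrow>
      Le R X Z (RComp R X Y Z (Reidx R f g \<alpha>) (Reidx R g h \<beta>)) (Reidx R f h (RComp R A B C \<alpha> \<beta>))"
    and conv_closed: "X \<in> Obj (Base R) \<Longrightarrow> Y \<in> Obj (Base R) \<Longrightarrow>
      \<alpha> \<in> Rel R X Y \<Longrightarrow> Conv R X Y \<alpha> \<in> Rel R Y X"
    and conv_mono: "X \<in> Obj (Base R) \<Longrightarrow> Y \<in> Obj (Base R) \<Longrightarrow>
      monotone_on (Rel R X Y) (Le R X Y) (Le R Y X) (Conv R X Y)"
    and conv_lax: "f \<in> Hom (Base R) X A \<Longrightarrow> g \<in> Hom (Base R) Y B \<Longrightarrow> \<alpha> \<in> Rel R A B \<Longrightarrow>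
      Le R Y X (Conv R X Y (Reidx R f g \<alpha>)) (Reidx R g f (Conv R A B \<alpha>))"
    and rcomp_assoc: "W \<in> Obj (Base R) \<Longrightarrow> X \<in> Obj (Base R) \<Longrightarrow> Y \<in> Obj (Base R) \<Longrightarrow>
      Z \<in> Obj (Base R) \<Longrightarrow> \<alpha> \<in> Rel R W X \<Longrightarrow> \<beta> \<in> Rel R X Y \<Longrightarrow> \<gamma> \<in> Rel R Y Z \<Longrightarrow>
      RComp R W Y Z (RComp R W X Y \<alpha> \<beta>) \<gamma> = RComp R W X Z \<alpha> (RComp R X Y Z \<beta> \<gamma>)"
    and rcomp_diag_left: "X \<in> Obj (Base R) \<Longrightarrow> Y \<in> Obj (Base R) \<Longrightarrow> \<alpha> \<in> Rel R X Y \<Longrightarrow>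
      RComp R X X Y (Diag R X) \<alpha> = \<alpha>"
    and rcomp_diag_right: "X \<in> Obj (Base R) \<Longrightarrow> Y \<in> Obj (Base R) \<Longrightarrow> \<alpha> \<in> Rel R X Y \<Longrightarrow>
      RComp R X Y Y \<alpha> (Diag R Y) = \<alpha>"
    and conv_rcomp: "X \<in> Obj (Base R) \<Longrightarrow> Y \<in> Obj (Base R) \<Longrightarrow> Z \<in> Obj (Base R) \<Longrightarrow>
      \<alpha> \<in> Rel R X Y \<Longrightarrow> \<beta> \<in> Rel R Y Z \<Longrightarrow>
      Conv R X Z (RComp R X Y Z \<alpha> \<beta>) = RComp R Z Y X (Conv R Y Z \<beta>) (Conv R X Y \<alpha>)"
    and conv_diag: "X \<in> Obj (Base R) \<Longrightarrow> Conv R X X (Diag R X) = Diag R X"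
    and conv_conv: "X \<in> Obj (Base R) \<Longrightarrow> Y \<in> Obj (Base R) \<Longrightarrow> \<alpha> \<in> Rel R X Y \<Longrightarrow>
      Conv R Y X (Conv R X Y \<alpha>) = \<alpha>"

definition Graph :: "('o, 'a, 'r) doctrine \<Rightarrow> 'a \<Rightarrow> 'r" where
  "Graph R f =
     (let Y = Cod (Base R) f in Reidx R f (Id (Base R) Y) (Diag R Y))"

definition CoGraph :: "('o, 'a, 'r) doctrine \<Rightarrow> 'a \<Rightarrow> 'r" where
  "CoGraph R f = Conv R (Dom (Base R) f) (Cod (Base R) f) (Graph R f)"

text \<open>$\Gamma_f;\Gamma_f^\bot \in R(X,X)$ and $\Gamma_f^\bot;\Gamma_f \in R(Y,Y)$
  for $f : X \to Y$.\<close>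

definition Ker :: "('o, 'a, 'r) doctrine \<Rightarrow> 'a \<Rightarrow> 'r" where
  "Ker R f =
     (let X = Dom (Base R) f; Y = Cod (Base R) f
      in RComp R X Y X (Graph R f) (CoGraph R f))"

definition Img :: "('o, 'a, 'r) doctrine \<Rightarrow> 'a \<Rightarrow> 'r" where
  "Img R f =
     (let X = Dom (Base R) f; Y = Cod (Base R) f
      in RComp R Y X Y (CoGraph R f) (Graph R f))"

definition R_equivalence :: "('o, 'a, 'r) doctrine \<Rightarrow> 'o \<Rightarrow> 'r \<Rightarrow> bool" where
  "R_equivalence R X \<rho> \<longleftrightarrow>
     X \<in> Obj (Base R) \<and> \<rho> \<in> Rel R X X \<and>
     Le R X X (Diag R X) \<rho> \<and>
     Le R X X (Conv R X X \<rho>) \<rho> \<and>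
     Le R X X (RComp R X X X \<rho> \<rho>) \<rho>"

definition quotient_arrow_of :: "('o, 'a, 'r) doctrine \<Rightarrow> 'o \<Rightarrow> 'r \<Rightarrow> 'a \<Rightarrow> bool" where
  "quotient_arrow_of R X \<rho> q \<longleftrightarrow>
     R_equivalence R X \<rho> \<and>
     q \<in> Arr (Base R) \<and> Dom (Base R) q = X \<and>
     Le R X X \<rho> (Ker R q) \<and>
     (\<forall>Z\<in>Obj (Base R). \<forall>f\<in>Hom (Base R) X Z. Le R X X \<rho> (Ker R f) \<longrightarrow>
        (\<exists>!h. h \<in> Hom (Base R) (Cod (Base R) q) Z \<and> f = h \<cdot>\<^bsub>Base R\<^esub> q))"

definition quotient_arrow :: "('o, 'a, 'r) doctrine \<Rightarrow> 'a \<Rightarrow> bool" where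
  "quotient_arrow R q \<longleftrightarrow> (\<exists>X \<rho>. quotient_arrow_of R X \<rho> q)"

definition effective_for :: "('o, 'a, 'r) doctrine \<Rightarrow> 'r \<Rightarrow> 'a \<Rightarrow> bool" where
  "effective_for R \<rho> q \<longleftrightarrow> \<rho> = Ker R q"

definition descent :: "('o, 'a, 'r) doctrine \<Rightarrow> 'a \<Rightarrow> bool" where
  "descent R q \<longleftrightarrow> (let W = Cod (Base R) q in Le R W W (Diag R W) (Img R q))"

definition has_quotients :: "('o, 'a, 'r) doctrine \<Rightarrow> bool" where
  "has_quotients R \<longleftrightarrow>
     (\<forall>X \<rho>. R_equivalence R X \<rho> \<longrightarrow>
        (\<exists>q. quotient_arrow_of R X \<rho> q \<and> effective_for R \<rho> q \<and> descent R q))"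

definition extensional_doctrine :: "('o, 'a, 'r) doctrine \<Rightarrow> bool" where
  "extensional_doctrine R \<longleftrightarrow>
     (\<forall>X\<in>Obj (Base R). \<forall>Y\<in>Obj (Base R). \<forall>f\<in>Hom (Base R) X Y. \<forall>g\<in>Hom (Base R) X Y.
        Le R X X (Diag R X) (Reidx R f g (Diag R Y)) \<longrightarrow> f = g)"


section \<open>The 2-category of extensional relational doctrines with quotients\<close>

definition EQRD_object :: "('o, 'a, 'r) doctrine \<Rightarrow> bool" where
  "EQRD_object R \<longleftrightarrow> relational_doctrine R \<and> extensional_doctrine R \<and> has_quotients R"

text \<open>\<open>Hat F\<close> is $\widehat F$ and \<open>Bar F X Y\<close> is $\overline F_{X,Y}$.\<close>

record ('o, 'a, 'r, 'p, 'b, 's) one_arrow =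
  Hat :: "('o, 'a, 'p, 'b) ftor"
  Bar :: "'o \<Rightarrow> 'o \<Rightarrow> 'r \<Rightarrow> 's"

locale EQRD_1_arrow =
  fixes R :: "('o, 'a, 'r) doctrine" and S :: "('p, 'b, 's) doctrine"
    and F :: "('o, 'a, 'r, 'p, 'b, 's) one_arrow"
  assumes source: "EQRD_object R"
    and target: "EQRD_object S"
    and hat_functor: "cat_functor (Base R) (Base S) (Hat F)"
    and bar_closed: "X \<in> Obj (Base R) \<Longrightarrow> Y \<in> Obj (Base R) \<Longrightarrow> \<alpha> \<in> Rel R X Y \<Longrightarrow>
      Bar F X Y \<alpha> \<in> Rel S (FObj (Hat F) X) (FObj (Hat F) Y)"
    and bar_mono: "X \<in> Obj (Base R) \<Longrightarrow> Y \<in> Obj (Base R) \<Longrightarrow>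
      monotone_on (Rel R X Y) (Le R X Y) (Le S (FObj (Hat F) X) (FObj (Hat F) Y)) (Bar F X Y)"
    and bar_natural: "f \<in> Hom (Base R) X A \<Longrightarrow> g \<in> Hom (Base R) Y B \<Longrightarrow> \<alpha> \<in> Rel R A B \<Longrightarrow>
      Bar F X Y (Reidx R f g \<alpha>) = Reidx S (FArr (Hat F) f) (FArr (Hat F) g) (Bar F A B \<alpha>)"
    and bar_diag: "X \<in> Obj (Base R) \<Longrightarrow> Bar F X X (Diag R X) = Diag S (FObj (Hat F) X)"
    and bar_rcomp: "X \<in> Obj (Base R) \<Longrightarrow> Y \<in> Obj (Base R) \<Longrightarrow> Z \<in> Obj (Base R) \<Longrightarrow>
      \<alpha> \<in> Rel R X Y \<Longrightarrow> \<beta> \<in> Rel R Y Z \<Longrightarrow>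
      Bar F X Z (RComp R X Y Z \<alpha> \<beta>) =
        RComp S (FObj (Hat F) X) (FObj (Hat F) Y) (FObj (Hat F) Z) (Bar F X Y \<alpha>) (Bar F Y Z \<beta>)"
    and bar_conv: "X \<in> Obj (Base R) \<Longrightarrow> Y \<in> Obj (Base R) \<Longrightarrow> \<alpha> \<in> Rel R X Y \<Longrightarrow>
      Bar F Y X (Conv R X Y \<alpha>) = Conv S (FObj (Hat F) X) (FObj (Hat F) Y) (Bar F X Y \<alpha>)"
    and preserves_quotients: "quotient_arrow_of R X \<rho> q \<Longrightarrow>
      quotient_arrow_of S (FObj (Hat F) X) (Bar F X X \<rho>) (FArr (Hat F) q)"

definition id_1_arrow :: "('o, 'a, 'r, 'o, 'a, 'r) one_arrow" where
  "id_1_arrow = \<lparr>Hat = \<lparr>FObj = \<lambda>X. X, FArr = \<lambda>f. f\<rparr>, Bar = \<lambda>X Y \<alpha>. \<alpha>\<rparr>"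

definition comp_1_arrow ::
  "('p, 'b, 's, 'q, 'c, 't) one_arrow \<Rightarrow> ('o, 'a, 'r, 'p, 'b, 's) one_arrow \<Rightarrow>
    ('o, 'a, 'r, 'q, 'c, 't) one_arrow" where
  "comp_1_arrow G F =
     \<lparr>Hat = \<lparr>FObj = \<lambda>X. FObj (Hat G) (FObj (Hat F) X), FArr = \<lambda>f. FArr (Hat G) (FArr (Hat F) f)\<rparr>,
      Bar = \<lambda>X Y \<alpha>. Bar G (FObj (Hat F) X) (FObj (Hat F) Y) (Bar F X Y \<alpha>)\<rparr>"

definition EQRD_2_arrow ::
  "('o, 'a, 'r) doctrine \<Rightarrow> ('p, 'b, 's) doctrine \<Rightarrow> ('o, 'a, 'r, 'p, 'b, 's) one_arrow \<Rightarrow>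
    ('o, 'a, 'r, 'p, 'b, 's) one_arrow \<Rightarrow> ('o \<Rightarrow> 'b) \<Rightarrow> bool" where
  "EQRD_2_arrow R S F G \<theta> \<longleftrightarrow>
     EQRD_1_arrow R S F \<and> EQRD_1_arrow R S G \<and>
     nat_trans (Base R) (Base S) (Hat F) (Hat G) \<theta> \<and>
     (\<forall>X\<in>Obj (Base R). \<forall>Y\<in>Obj (Base R). \<forall>\<alpha>\<in>Rel R X Y.
        Le S (FObj (Hat F) X) (FObj (Hat F) Y)
          (Bar F X Y \<alpha>) (Reidx S (\<theta> X) (\<theta> Y) (Bar G X Y \<alpha>)))"

record ('o, 'a, 'r) doctrine_monad =
  Endo :: "('o, 'a, 'r, 'o, 'a, 'r) one_arrow"
  Unit :: "'o \<Rightarrow> 'a"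
  Mult :: "'o \<Rightarrow> 'a"

abbreviation TObj :: "('o, 'a, 'r) doctrine_monad \<Rightarrow> 'o \<Rightarrow> 'o" where
  "TObj T \<equiv> FObj (Hat (Endo T))"

abbreviation TArr :: "('o, 'a, 'r) doctrine_monad \<Rightarrow> 'a \<Rightarrow> 'a" where
  "TArr T \<equiv> FArr (Hat (Endo T))"

abbreviation TRel :: "('o, 'a, 'r) doctrine_monad \<Rightarrow> 'o \<Rightarrow> 'o \<Rightarrow> 'r \<Rightarrow> 'r" where
  "TRel T \<equiv> Bar (Endo T)"

locale EQRD_monad =
  fixes R :: "('o, 'a, 'r) doctrine" and T :: "('o, 'a, 'r) doctrine_monad"
  assumes endo: "EQRD_1_arrow R R (Endo T)"
    and unit: "EQRD_2_arrow R R id_1_arrow (Endo T) (Unit T)"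
    and mult: "EQRD_2_arrow R R (comp_1_arrow (Endo T) (Endo T)) (Endo T) (Mult T)"
    and unit_left: "X \<in> Obj (Base R) \<Longrightarrow>
      Mult T X \<cdot>\<^bsub>Base R\<^esub> Unit T (TObj T X) = Id (Base R) (TObj T X)"
    and unit_right: "X \<in> Obj (Base R) \<Longrightarrow>
      Mult T X \<cdot>\<^bsub>Base R\<^esub> TArr T (Unit T X) = Id (Base R) (TObj T X)"
    and mult_assoc: "X \<in> Obj (Base R) \<Longrightarrow>
      Mult T X \<cdot>\<^bsub>Base R\<^esub> Mult T (TObj T X) = Mult T X \<cdot>\<^bsub>Base R\<^esub> TArr T (Mult T X)"


section \<open>The Eilenberg--Moore doctrine\<close>

definition EM_algebra :: "('o, 'a, 'r) doctrine \<Rightarrow> ('o, 'a, 'r) doctrine_monad \<Rightarrow> 'o \<times> 'a \<Rightarrow> bool" where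
  "EM_algebra R T A \<longleftrightarrow> (case A of (X, a) \<Rightarrow>
     X \<in> Obj (Base R) \<and> a \<in> Hom (Base R) (TObj T X) X \<and>
     a \<cdot>\<^bsub>Base R\<^esub> Unit T X = Id (Base R) X \<and>
     a \<cdot>\<^bsub>Base R\<^esub> TArr T a = a \<cdot>\<^bsub>Base R\<^esub> Mult T X)"

text \<open>The same arrow of the base can underlie homomorphisms between different algebras, so an
  arrow of the Eilenberg--Moore category is a triple of source, underlying arrow and target.\<close>

type_synonym ('o, 'a) EM_arr = "('o \<times> 'a) \<times> 'a \<times> ('o \<times> 'a)"

definition EM_category ::
  "('o, 'a, 'r) doctrine \<Rightarrow> ('o, 'a, 'r) doctrine_monad \<Rightarrow> ('o \<times> 'a, ('o, 'a) EM_arr) cat" where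
  "EM_category R T =
     \<lparr>Obj = {A. EM_algebra R T A},
      Arr = {((X, a), f, (Y, b)) | X a f Y b.
               EM_algebra R T (X, a) \<and> EM_algebra R T (Y, b) \<and> f \<in> Hom (Base R) X Y \<and>
               f \<cdot>\<^bsub>Base R\<^esub> a = b \<cdot>\<^bsub>Base R\<^esub> TArr T f},
      Dom = (\<lambda>(A, f, B). A),
      Cod = (\<lambda>(A, f, B). B),
      Id = (\<lambda>(X, a). ((X, a), Id (Base R) X, (X, a))),
      Comp = (\<lambda>(B, g, C) (A, f, B'). (A, g \<cdot>\<^bsub>Base R\<^esub> f, C))\<rparr>"

definition EM_Rel ::
  "('o, 'a, 'r) doctrine \<Rightarrow> ('o, 'a, 'r) doctrine_monad \<Rightarrow> 'o \<times> 'a \<Rightarrow> 'o \<times> 'a \<Rightarrow> 'r set" where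
  "EM_Rel R T = (\<lambda>(X, a) (Y, b). {\<alpha> \<in> Rel R X Y.
     Le R X Y
       (RComp R X (TObj T Y) Y
          (RComp R X (TObj T X) (TObj T Y) (CoGraph R a) (TRel T X Y \<alpha>))
          (Graph R b))
       \<alpha>})"

definition EM_doctrine ::
  "('o, 'a, 'r) doctrine \<Rightarrow> ('o, 'a, 'r) doctrine_monad \<Rightarrow>
    ('o \<times> 'a, ('o, 'a) EM_arr, 'r) doctrine" where
  "EM_doctrine R T =
     \<lparr>Base = EM_category R T,
      Rel = EM_Rel R T,
      Le = (\<lambda>(X, a) (Y, b). Le R X Y),
      Reidx = (\<lambda>(A, f, A') (B, g, B'). Reidx R f g),
      Diag = (\<lambda>(X, a). Diag R X),
      RComp = (\<lambda>(X, a) (Y, b) (Z, c). RComp R X Y Z),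
      Conv = (\<lambda>(X, a) (Y, b). Conv R X Y)\<rparr>"

definition free_algebras ::
  "('o, 'a, 'r) doctrine \<Rightarrow> ('o, 'a, 'r) doctrine_monad \<Rightarrow> ('o, 'a) cat \<Rightarrow>
    ('o \<times> 'a, ('o, 'a) EM_arr) cat" where
  "free_algebras R T G =
     full_subcategory_on (EM_category R T) {(TObj T X, Mult T X) | X. X \<in> Obj G}"


section \<open>Projective covers\<close>

definition R_projective :: "('o, 'a, 'r) doctrine \<Rightarrow> 'o \<Rightarrow> bool" where
  "R_projective R P \<longleftrightarrow>
     P \<in> Obj (Base R) \<and>
     (\<forall>X\<in>Obj (Base R). \<forall>Y\<in>Obj (Base R).
        \<forall>f\<in>Hom (Base R) P Y. \<forall>q\<in>Hom (Base R) X Y. quotient_arrow R q \<longrightarrow>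
          (\<exists>h\<in>Hom (Base R) P X. f = q \<cdot>\<^bsub>Base R\<^esub> h))"

definition R_projective_cover :: "('o, 'a, 'r) doctrine \<Rightarrow> ('o, 'a) cat \<Rightarrow> bool" where
  "R_projective_cover R G \<longleftrightarrow>
     full_subcategory G (Base R) \<and>
     (\<forall>P\<in>Obj G. R_projective R P) \<and>
     (\<forall>X\<in>Obj (Base R). \<exists>P\<in>Obj G. \<exists>q\<in>Hom (Base R) P X. quotient_arrow R q)"

end

theory Submission
  imports Defs
begin

text \<open>
  Everything rests on one comparison (\<open>EM_quotient_arrow_iff\<close>): a homomorphism of algebras is a
  quotient arrow of the Eilenberg--Moore doctrine if and only if its underlying arrow is a quotient
  arrow of $R$. Once this is known, lifting problems and covers of algebras become lifting problems
  and covers in the base.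

  Assume that $\mathcal G$ is an $R$-projective cover. A homomorphism $f : (TP,\mu_P) \to (Y,b)$ is
  lifted along a quotient $q : (X,a) \to (Y,b)$ by lifting $f \circ \eta_P$ to $k : P \to X$ and
  taking the homomorphic extension $a \circ Tk$. An algebra $(X,a)$ is covered as follows: choose a
  quotient arrow $q : P \to X$ with $P$ in $\mathcal G$. Then $Tq$ is a quotient arrow because $T$
  preserves quotients, $a$ is one because extensionality makes every retraction a quotient of its
  kernel and $\eta_X$ is a section of $a$, and quotient arrows compose, so $a \circ Tq$ is a
  quotient homomorphism out of a free algebra. Conversely, for the identity monad the
  algebras are the pairs $(X,\mathrm{id}_X)$, so projective covers by free algebras are projective
  covers in the base.

  The comparison is proved by descending the algebra structure. If $(X,a)$ is an algebra and $\rho$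
  an equivalence relation of algebras on it, with effective quotient $p : X \to W$ in the base, then
  $p \circ a$ factors through the quotient arrow $Tp$, which yields the structure map of $W$
  (\<open>quotient_algebra\<close>); the algebra laws and the homomorphism property of induced maps hold because
  $p$, $Tp$ and $TTp$ can be cancelled. Hence $p$ is also the quotient of $\rho$ among algebras, and
  any other one differs from it by a retraction, which is itself a quotient arrow.

  Graphs are avoided as far as possible: the kernel $\Gamma_f;\Gamma_f^\bot$ is $R_{f,f}(d_Y)$
  (\<open>ker_eq_reidx\<close>), and the closure condition defining relations of algebras says
  $\overline T\alpha \le R_{a,b}(\alpha)$ (\<open>transpose_le_iff_le_reidx\<close>), so that functoriality of
  reindexing replaces most of the relational calculus.
\<close>


section \<open>Reindexing, kernels and graphs\<close>

context relational_doctrine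
begin

abbreviation obj :: "'o set" where "obj \<equiv> Obj (Base R)"
abbreviation hom :: "'o \<Rightarrow> 'o \<Rightarrow> 'a set" where "hom \<equiv> Hom (Base R)"
abbreviation ident :: "'o \<Rightarrow> 'a" where "ident \<equiv> Id (Base R)"
abbreviation comp :: "'a \<Rightarrow> 'a \<Rightarrow> 'a" (infixr "\<bullet>" 70) where "g \<bullet> f \<equiv> g \<cdot>\<^bsub>Base R\<^esub> f"

lemmas id_hom = category.id_hom [OF base]
lemmas comp_hom = category.comp_hom [OF base]
lemmas comp_id_right = category.comp_id_right [OF base]
lemmas comp_id_left = category.comp_id_left [OF base]
lemmas comp_assoc = category.comp_assoc [OF base]

lemma hom_dom: "f \<in> hom X Y \<Longrightarrow> Dom (Base R) f = X"
  and hom_cod: "f \<in> hom X Y \<Longrightarrow> Cod (Base R) f = Y"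
  and hom_arr: "f \<in> hom X Y \<Longrightarrow> f \<in> Arr (Base R)"
  by (auto simp: Hom_def)

lemma hom_dom_obj: "f \<in> hom X Y \<Longrightarrow> X \<in> obj"
  and hom_cod_obj: "f \<in> hom X Y \<Longrightarrow> Y \<in> obj"
  using category.dom_obj [OF base] category.cod_obj [OF base] by (auto simp: Hom_def)

lemma le_refl: "X \<in> obj \<Longrightarrow> Y \<in> obj \<Longrightarrow> \<alpha> \<in> Rel R X Y \<Longrightarrow> Le R X Y \<alpha> \<alpha>"
  using rel_refl by (blast dest: reflp_onD)

lemma le_trans:
  "Le R X Y \<alpha> \<beta> \<Longrightarrow> Le R X Y \<beta> \<gamma> \<Longrightarrow> X \<in> obj \<Longrightarrow> Y \<in> obj \<Longrightarrow>
    \<alpha> \<in> Rel R X Y \<Longrightarrow> \<beta> \<in> Rel R X Y \<Longrightarrow> \<gamma> \<in> Rel R X Y \<Longrightarrow> Le R X Y \<alpha> \<gamma>"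
  using rel_trans by (blast dest: transp_onD)

lemma le_antisym:
  "Le R X Y \<alpha> \<beta> \<Longrightarrow> Le R X Y \<beta> \<alpha> \<Longrightarrow> X \<in> obj \<Longrightarrow> Y \<in> obj \<Longrightarrow>
    \<alpha> \<in> Rel R X Y \<Longrightarrow> \<beta> \<in> Rel R X Y \<Longrightarrow> \<alpha> = \<beta>"
  using rel_antisym by (blast dest: antisymp_onD)

lemma le_reidx:
  "f \<in> hom X A \<Longrightarrow> g \<in> hom Y B \<Longrightarrow> \<alpha> \<in> Rel R A B \<Longrightarrow> \<beta> \<in> Rel R A B \<Longrightarrow> Le R A B \<alpha> \<beta> \<Longrightarrow>
    Le R X Y (Reidx R f g \<alpha>) (Reidx R f g \<beta>)"
  using reidx_mono by (blast dest: monotone_onD)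

lemma le_conv:
  "X \<in> obj \<Longrightarrow> Y \<in> obj \<Longrightarrow> \<alpha> \<in> Rel R X Y \<Longrightarrow> \<beta> \<in> Rel R X Y \<Longrightarrow> Le R X Y \<alpha> \<beta> \<Longrightarrow>
    Le R Y X (Conv R X Y \<alpha>) (Conv R X Y \<beta>)"
  using conv_mono by (blast dest: monotone_onD)

lemma graph_eq: "f \<in> hom X Y \<Longrightarrow> Graph R f = Reidx R f (ident Y) (Diag R Y)"
  by (simp add: Graph_def hom_cod)

text \<open>Converse is an involution, so its lax naturality is in fact an equality.\<close>

lemma cograph_eq:
  assumes f: "f \<in> hom X Y"
  shows "CoGraph R f = Reidx R (ident Y) f (Diag R Y)"
proof -
  note o = hom_dom_obj [OF f] hom_cod_obj [OF f]
  note i = id_hom [OF o(2)]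
  note d = diag_closed [OF o(2)]
  let ?g = "Reidx R f (ident Y) (Diag R Y)" and ?c = "Reidx R (ident Y) f (Diag R Y)"
  have g: "?g \<in> Rel R X Y" and c: "?c \<in> Rel R Y X"
    using reidx_closed f i d by blast+
  have le: "Le R Y X (Conv R X Y ?g) ?c" and le': "Le R X Y (Conv R Y X ?c) ?g"
    using conv_lax [OF f i d] conv_lax [OF i f d] by (simp_all add: conv_diag o)
  have "Le R Y X (Conv R X Y (Conv R Y X ?c)) (Conv R X Y ?g)"
    using le_conv [OF o(1) o(2) conv_closed [OF o(2) o(1) c] g le'] .
  then have "Conv R X Y ?g = ?c"
    using le_antisym [OF le _ o(2) o(1) conv_closed [OF o g] c] by (simp add: conv_conv o c)
  then show ?thesis
    by (simp add: CoGraph_def graph_eq [OF f] hom_dom [OF f] hom_cod [OF f])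
qed

lemma graph_closed: "f \<in> hom X Y \<Longrightarrow> Graph R f \<in> Rel R X Y"
  and cograph_closed: "f \<in> hom X Y \<Longrightarrow> CoGraph R f \<in> Rel R Y X"
  using reidx_closed [OF _ id_hom diag_closed] reidx_closed [OF id_hom _ diag_closed]
  by (simp_all add: graph_eq cograph_eq hom_cod_obj)

text \<open>The inclusion $\Gamma_f;\Gamma_f^\bot \le R_{f,f}(d_Y)$ is lax naturality of composition. For the
  other one, write $R_{f,f}(d_Y)$ both as $R_{\mathrm{id},f}(\Gamma_f)$ and as
  $R_{f,\mathrm{id}}(\Gamma_f^\bot)$: the composite of these two is below $\Gamma_f;\Gamma_f^\bot$, again
  by laxness, and $d_X \le R_{f,f}(d_Y)$ makes $R_{f,f}(d_Y)$ below its own square.\<close>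

lemma ker_eq_reidx:
  assumes f: "f \<in> hom X Y"
  shows "Ker R f = Reidx R f f (Diag R Y)"
proof -
  note o = hom_dom_obj [OF f] hom_cod_obj [OF f]
  note iX = id_hom [OF o(1)] and iY = id_hom [OF o(2)]
  note d = diag_closed [OF o(2)]
  let ?k = "Reidx R f f (Diag R Y)" and ?g = "Graph R f" and ?c = "CoGraph R f"
  note g = graph_closed [OF f] and c = cograph_closed [OF f]
  have k: "?k \<in> Rel R X X" using reidx_closed f d by blast
  have gc: "RComp R X Y X ?g ?c \<in> Rel R X X" by (simp add: rcomp_closed o g c)
  have kk: "RComp R X X X ?k ?k \<in> Rel R X X" by (simp add: rcomp_closed o k)
  have le: "Le R X X (RComp R X Y X ?g ?c) ?k"
    using rcomp_lax [OF f iY f d d]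
    by (simp add: graph_eq [OF f] cograph_eq [OF f] rcomp_diag_left o d)
  have "Le R X X (RComp R X X X (Diag R X) ?k) (RComp R X X X ?k ?k)"
    using rcomp_mono o diag_closed k diag_lax [OF f] le_refl by simp
  then have "Le R X X ?k (RComp R X X X ?k ?k)"
    by (simp add: rcomp_diag_left o k)
  moreover have "Le R X X (RComp R X X X ?k ?k) (RComp R X Y X ?g ?c)"
  proof -
    have "Reidx R (ident X) f ?g = ?k" "Reidx R f (ident X) ?c = ?k"
      by (simp_all only: graph_eq [OF f] cograph_eq [OF f] reidx_comp [OF iX f f iY d, symmetric]
          reidx_comp [OF f iY iX f d, symmetric] comp_id_left [OF f] comp_id_right [OF f])
    then show ?thesis
      using rcomp_lax [OF iX f iX g c] by (simp add: reidx_id o gc)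
  qed
  ultimately have "Le R X X ?k (RComp R X Y X ?g ?c)"
    using le_trans o k kk gc by blast
  then have "RComp R X Y X ?g ?c = ?k"
    using le_antisym [OF le] o gc k by blast
  then show ?thesis by (simp add: Ker_def hom_dom [OF f] hom_cod [OF f])
qed

lemma ker_closed: "f \<in> hom X Y \<Longrightarrow> Ker R f \<in> Rel R X X"
  by (simp add: ker_eq_reidx reidx_closed diag_closed hom_cod_obj)

lemma diag_le_ker: "f \<in> hom X Y \<Longrightarrow> Le R X X (Diag R X) (Ker R f)"
  by (simp add: ker_eq_reidx diag_lax)

lemma ker_comp:
  "f \<in> hom X Y \<Longrightarrow> g \<in> hom Y Z \<Longrightarrow> Ker R (g \<bullet> f) = Reidx R f f (Ker R g)"
  using reidx_comp [of f X Y g Z f X Y g Z] ker_eq_reidx [OF comp_hom [of f X Y g Z]]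
  by (simp add: ker_eq_reidx [of f X Y] ker_eq_reidx [of g Y Z] diag_closed hom_cod_obj)

lemma ker_le_ker_comp:
  "f \<in> hom X Y \<Longrightarrow> g \<in> hom Y Z \<Longrightarrow> Le R X X (Ker R f) (Ker R (g \<bullet> f))"
  by (simp add: ker_comp ker_eq_reidx [of f] le_reidx diag_closed ker_closed diag_le_ker hom_cod_obj)

lemma ker_R_equivalence:
  assumes f: "f \<in> hom X Y"
  shows "R_equivalence R X (Ker R f)"
proof -
  note o = hom_dom_obj [OF f] hom_cod_obj [OF f]
  note d = diag_closed [OF o(2)]
  have "Le R X X (Conv R X X (Ker R f)) (Ker R f)"
    using conv_lax [OF f f d] by (simp add: ker_eq_reidx [OF f] conv_diag o)
  moreover have "Le R X X (RComp R X X X (Ker R f) (Ker R f)) (Ker R f)"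
    using rcomp_lax [OF f f f d d] by (simp add: ker_eq_reidx [OF f] rcomp_diag_left d o)
  ultimately show ?thesis
    using o ker_closed [OF f] diag_le_ker [OF f] by (simp add: R_equivalence_def)
qed

text \<open>Graphs are maps: $\Gamma_f^\bot;\tau;\Gamma_g \le \alpha$ and
  $\tau \le \Gamma_f;\alpha;\Gamma_g^\bot$ are equivalent because $d_X \le \Gamma_f;\Gamma_f^\bot$ and
  $\Gamma_f^\bot;\Gamma_f \le d_A$, and $\Gamma_f;\alpha;\Gamma_g^\bot$ is $R_{f,g}(\alpha)$. It is
  this form of the closure condition on relations between algebras that gets used.\<close>

lemma transpose_le_iff_le_reidx:
  assumes f: "f \<in> hom X A" and g: "g \<in> hom Y B"
    and \<tau>: "\<tau> \<in> Rel R X Y" and \<alpha>: "\<alpha> \<in> Rel R A B"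
  shows "Le R A B (RComp R A Y B (RComp R A X Y (CoGraph R f) \<tau>) (Graph R g)) \<alpha> \<longleftrightarrow>
    Le R X Y \<tau> (Reidx R f g \<alpha>)"
proof -
  note o = hom_dom_obj [OF f] hom_cod_obj [OF f] hom_dom_obj [OF g] hom_cod_obj [OF g]
  note iA = id_hom [OF o(2)] and iB = id_hom [OF o(4)]
  note dA = diag_closed [OF o(2)] and dB = diag_closed [OF o(4)]
  note gs = graph_closed [OF f] cograph_closed [OF f] graph_closed [OF g] cograph_closed [OF g]
  note r\<alpha> = reidx_closed [OF f g \<alpha>]
  let ?c = "RComp R A X Y (CoGraph R f)"
  let ?t = "RComp R A Y B (?c \<tau>) (Graph R g)"
  have c: "?c \<beta> \<in> Rel R A Y" if "\<beta> \<in> Rel R X Y" for \<beta>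
    by (simp add: rcomp_closed that o gs)
  have t: "?t \<in> Rel R A B" by (simp add: c [OF \<tau>] rcomp_closed o gs)
  show ?thesis
  proof
    assume le: "Le R X Y \<tau> (Reidx R f g \<alpha>)"
    have m: "Le R A B ?t (RComp R A Y B (?c (Reidx R f g \<alpha>)) (Graph R g))"
      using rcomp_mono le_refl le o gs c \<tau> r\<alpha> by simp
    have i\<alpha>: "Reidx R (ident A) g \<alpha> \<in> Rel R A Y" using reidx_closed iA g \<alpha> by blast
    have "Le R A Y (?c (Reidx R f g \<alpha>)) (Reidx R (ident A) g \<alpha>)"
      using rcomp_lax [OF iA f g dA \<alpha>] by (simp add: cograph_eq [OF f] rcomp_diag_left o \<alpha>)
    then have m': "Le R A B (RComp R A Y B (?c (Reidx R f g \<alpha>)) (Graph R g))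
        (RComp R A Y B (Reidx R (ident A) g \<alpha>) (Graph R g))"
      using rcomp_mono le_refl o gs c r\<alpha> i\<alpha> by simp
    have m'': "Le R A B (RComp R A Y B (Reidx R (ident A) g \<alpha>) (Graph R g)) \<alpha>"
      using rcomp_lax [OF iA g iB \<alpha> dB] by (simp add: graph_eq [OF g] rcomp_diag_right reidx_id o \<alpha>)
    have cl: "RComp R A Y B (?c (Reidx R f g \<alpha>)) (Graph R g) \<in> Rel R A B"
      "RComp R A Y B (Reidx R (ident A) g \<alpha>) (Graph R g) \<in> Rel R A B"
      by (simp_all add: rcomp_closed o gs c r\<alpha> i\<alpha>)
    show "Le R A B ?t \<alpha>"
      using le_trans [OF m le_trans [OF m' m'']] o cl t \<alpha> by blast
  next
    assume le: "Le R A B ?t \<alpha>"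
    \<comment> \<open>Compose with the kernels, which contain the diagonals, and transpose inside.\<close>
    have kf: "RComp R X A X (Graph R f) (CoGraph R f) = Ker R f"
      and kg: "RComp R Y B Y (Graph R g) (CoGraph R g) = Ker R g"
      by (simp_all add: Ker_def hom_dom [OF f] hom_cod [OF f] hom_dom [OF g] hom_cod [OF g])
    let ?s = "\<lambda>\<beta>. RComp R X A Y (Graph R f) (RComp R A B Y \<beta> (CoGraph R g))"
    have s: "?s \<beta> \<in> Rel R X Y" if "\<beta> \<in> Rel R A B" for \<beta>
      by (simp add: rcomp_closed that o gs)
    have "?s ?t = RComp R X Y Y (RComp R X X Y (Ker R f) \<tau>) (Ker R g)"
      using o gs c \<tau> by (simp add: kf [symmetric] kg [symmetric] rcomp_assoc rcomp_closed)
    moreover have "Le R X Y (RComp R X Y Y (RComp R X X Y (Diag R X) \<tau>) (Diag R Y))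
        (RComp R X Y Y (RComp R X X Y (Ker R f) \<tau>) (Ker R g))"
      using rcomp_mono rcomp_closed le_refl diag_closed o \<tau> ker_closed [OF f] ker_closed [OF g]
        diag_le_ker [OF f] diag_le_ker [OF g] by simp
    ultimately have m: "Le R X Y \<tau> (?s ?t)"
      using o \<tau> by (simp add: rcomp_diag_left rcomp_diag_right)
    have m': "Le R X Y (?s ?t) (?s \<alpha>)"
      by (simp add: rcomp_mono rcomp_closed le_refl le o gs t \<alpha>)
    have r: "Reidx R (ident A) g \<alpha> \<in> Rel R A Y" using reidx_closed iA g \<alpha> by blast
    have "Le R A Y (RComp R A B Y \<alpha> (CoGraph R g)) (Reidx R (ident A) g \<alpha>)"
      using rcomp_lax [OF iA iB g \<alpha> dB] by (simp add: cograph_eq [OF g] rcomp_diag_right reidx_id o \<alpha>)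
    then have m'': "Le R X Y (?s \<alpha>) (RComp R X A Y (Graph R f) (Reidx R (ident A) g \<alpha>))"
      by (simp add: rcomp_mono rcomp_closed le_refl o gs \<alpha> r)
    have m''': "Le R X Y (RComp R X A Y (Graph R f) (Reidx R (ident A) g \<alpha>)) (Reidx R f g \<alpha>)"
      using rcomp_lax [OF f iA g dA \<alpha>] by (simp add: graph_eq [OF f] rcomp_diag_left o \<alpha>)
    show "Le R X Y \<tau> (Reidx R f g \<alpha>)"
      using le_trans [OF m le_trans [OF m' le_trans [OF m'' m''']]] o s t \<alpha> \<tau> r\<alpha> r rcomp_closed gs
      by blast
  qed
qed


section \<open>Quotient arrows\<close>

text \<open>Descent says $d_Y \le \Gamma_q^\bot;\Gamma_q$, so $\alpha$ can be recovered from its reindexing as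
  $\alpha \le \Gamma_q^\bot;(\Gamma_q;\alpha;\Gamma_q^\bot);\Gamma_q$.\<close>

lemma descent_reflects_le:
  assumes q: "q \<in> hom X Y" and desc: "descent R q"
    and \<alpha>: "\<alpha> \<in> Rel R Y Y" and \<beta>: "\<beta> \<in> Rel R Y Y"
    and le: "Le R X X (Reidx R q q \<alpha>) (Reidx R q q \<beta>)"
  shows "Le R Y Y \<alpha> \<beta>"
proof -
  note o = hom_dom_obj [OF q] hom_cod_obj [OF q]
  note gs = graph_closed [OF q] cograph_closed [OF q]
  note r\<alpha> = reidx_closed [OF q q \<alpha>]
  let ?i = "RComp R Y X Y (CoGraph R q) (Graph R q)"
  let ?u = "RComp R X Y X (RComp R X Y Y (Graph R q) \<alpha>) (CoGraph R q)"
  let ?t = "\<lambda>\<tau>. RComp R Y X Y (RComp R Y X X (CoGraph R q) \<tau>) (Graph R q)"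
  have i: "?i \<in> Rel R Y Y" by (simp add: rcomp_closed o gs)
  have di: "Le R Y Y (Diag R Y) ?i"
    using desc by (simp add: descent_def Img_def hom_dom [OF q] hom_cod [OF q])
  have t: "?t \<tau> \<in> Rel R Y Y" if "\<tau> \<in> Rel R X X" for \<tau>
    by (simp add: rcomp_closed that o gs)
  have u: "?u \<in> Rel R X X" by (simp add: rcomp_closed o gs \<alpha>)
  have g\<alpha>: "RComp R X Y Y (Graph R q) \<alpha> \<in> Rel R X Y" by (simp add: rcomp_closed o gs \<alpha>)
  have "Le R X Y (RComp R X Y Y (Graph R q) \<alpha>) (Reidx R q (ident Y) \<alpha>)"
    using rcomp_lax [OF q id_hom [OF o(2)] id_hom [OF o(2)] diag_closed [OF o(2)] \<alpha>]
    by (simp add: graph_eq [OF q] rcomp_diag_left reidx_id o \<alpha>)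
  then have m: "Le R X X ?u (RComp R X Y X (Reidx R q (ident Y) \<alpha>) (CoGraph R q))"
    using rcomp_mono le_refl o gs g\<alpha> reidx_closed [OF q id_hom [OF o(2)] \<alpha>] by simp
  have "Le R X X (RComp R X Y X (Reidx R q (ident Y) \<alpha>) (CoGraph R q)) (Reidx R q q \<alpha>)"
    using rcomp_lax [OF q id_hom [OF o(2)] q \<alpha> diag_closed [OF o(2)]]
    by (simp add: cograph_eq [OF q] rcomp_diag_right o \<alpha>)
  then have "Le R X X ?u (Reidx R q q \<alpha>)"
    using le_trans [OF m] o u r\<alpha> rcomp_closed gs reidx_closed [OF q id_hom [OF o(2)] \<alpha>] by blast
  then have "Le R X X ?u (Reidx R q q \<beta>)"
    using le_trans le o u r\<alpha> reidx_closed [OF q q \<beta>] by blast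
  then have m': "Le R Y Y (?t ?u) \<beta>"
    using transpose_le_iff_le_reidx [OF q q u \<beta>] by blast
  have "?t ?u = RComp R Y Y Y (RComp R Y Y Y ?i \<alpha>) ?i"
    using o gs \<alpha> by (simp add: rcomp_assoc rcomp_closed)
  moreover have "Le R Y Y (RComp R Y Y Y (RComp R Y Y Y (Diag R Y) \<alpha>) (Diag R Y))
      (RComp R Y Y Y (RComp R Y Y Y ?i \<alpha>) ?i)"
    by (simp add: rcomp_mono rcomp_closed le_refl diag_closed o \<alpha> i di)
  ultimately have "Le R Y Y \<alpha> (?t ?u)"
    using o \<alpha> by (simp add: rcomp_diag_left rcomp_diag_right)
  then show ?thesis using le_trans [OF _ m'] o \<alpha> \<beta> t [OF u] by blast
qed

lemma quotient_factors:
  assumes "quotient_arrow_of R X \<rho> q" and q: "q \<in> hom X Y"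
    and "f \<in> hom X Z" and "Le R X X \<rho> (Ker R f)"
  shows "\<exists>!h. h \<in> hom Y Z \<and> f = h \<bullet> q"
  using assms hom_cod_obj [OF assms(3)] hom_cod [OF q] by (auto simp: quotient_arrow_of_def)

lemma quotient_arrow_of_epi:
  assumes Q: "quotient_arrow_of R X \<rho> q" and q: "q \<in> hom X Y"
    and u: "u \<in> hom Y Z" and v: "v \<in> hom Y Z" and eq: "u \<bullet> q = v \<bullet> q"
  shows "u = v"
proof -
  have r: "X \<in> obj" "\<rho> \<in> Rel R X X" "Le R X X \<rho> (Ker R q)"
    using Q by (auto simp: quotient_arrow_of_def R_equivalence_def)
  have "Le R X X \<rho> (Ker R (u \<bullet> q))"
    using le_trans [OF r(3) ker_le_ker_comp [OF q u]] r ker_closed q comp_hom [OF q u] by blast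
  then show ?thesis
    using quotient_factors [OF Q q comp_hom [OF q u]] u v eq by blast
qed

lemma quotient_arrow_epi:
  assumes "quotient_arrow R q" and q: "q \<in> hom X Y"
    and "u \<in> hom Y Z" "v \<in> hom Y Z" "u \<bullet> q = v \<bullet> q"
  shows "u = v"
proof -
  obtain \<rho> where "quotient_arrow_of R X \<rho> q"
    using assms(1) hom_dom [OF q] by (auto simp: quotient_arrow_def quotient_arrow_of_def)
  then show ?thesis using quotient_arrow_of_epi assms by blast
qed

lemma quotient_arrowI:
  assumes q: "q \<in> hom X Y"
    and ex: "\<And>Z f. f \<in> hom X Z \<Longrightarrow> Le R X X (Ker R q) (Ker R f) \<Longrightarrow> \<exists>h\<in>hom Y Z. f = h \<bullet> q"
    and epi: "\<And>Z u v. u \<in> hom Y Z \<Longrightarrow> v \<in> hom Y Z \<Longrightarrow> u \<bullet> q = v \<bullet> q \<Longrightarrow> u = v"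
  shows "quotient_arrow R q"
proof -
  have "quotient_arrow_of R X (Ker R q) q"
    unfolding quotient_arrow_of_def
  proof (intro conjI ballI impI)
    fix Z f assume "f \<in> hom X Z" "Le R X X (Ker R q) (Ker R f)"
    then obtain h where "h \<in> hom Y Z" "f = h \<bullet> q" using ex by blast
    then show "\<exists>!h. h \<in> hom (Cod (Base R) q) Z \<and> f = h \<bullet> q"
      using epi hom_cod [OF q] by metis
  qed (use ker_R_equivalence [OF q] hom_arr [OF q] hom_dom [OF q] hom_dom_obj [OF q] le_refl
        ker_closed [OF q] in auto)
  then show ?thesis by (auto simp: quotient_arrow_def)
qed

lemma retraction_epi:
  assumes a: "a \<in> hom A X" and s: "s \<in> hom X A" and as: "a \<bullet> s = ident X"
    and u: "u \<in> hom X Z" and v: "v \<in> hom X Z" and eq: "u \<bullet> a = v \<bullet> a"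
  shows "u = v"
proof -
  have "w = (w \<bullet> a) \<bullet> s" if "w \<in> hom X Z" for w
    by (simp only: comp_assoc [OF s a that] as comp_id_right [OF that])
  from this [OF u] this [OF v] show ?thesis by (simp only: eq)
qed

end

locale extensional_quotient_doctrine = relational_doctrine R
  for R :: "('o, 'a, 'r) doctrine" +
  assumes ext: "extensional_doctrine R" and quots: "has_quotients R"
begin

lemma effective_descent_quotient:
  assumes "R_equivalence R X \<rho>"
  obtains q W where "q \<in> hom X W" "quotient_arrow_of R X \<rho> q" "Ker R q = \<rho>" "descent R q"
  using assms quots
  by (force simp: has_quotients_def effective_for_def quotient_arrow_of_def Hom_def)

text \<open>Effectiveness and the order-reflecting effect of descent are only assumed of one quotient arrow
  for each equivalence relation, but quotients are unique up to isomorphism, so every quotient arrow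
  has both properties.\<close>

lemma quotient_arrow_ker_and_reflects:
  assumes Q: "quotient_arrow_of R X \<rho> q" and q: "q \<in> hom X Y"
  shows "\<rho> = Ker R q"
    and "\<alpha> \<in> Rel R Y Y \<Longrightarrow> \<beta> \<in> Rel R Y Y \<Longrightarrow>
      Le R X X (Reidx R q q \<alpha>) (Reidx R q q \<beta>) \<Longrightarrow> Le R Y Y \<alpha> \<beta>"
proof -
  have \<rho>: "R_equivalence R X \<rho>" "Le R X X \<rho> (Ker R q)"
    using Q by (auto simp: quotient_arrow_of_def)
  obtain p W where p: "p \<in> hom X W" and P: "quotient_arrow_of R X \<rho> p"
    and kp: "Ker R p = \<rho>" and dp: "descent R p"
    using effective_descent_quotient [OF \<rho>(1)] .
  note o = hom_dom_obj [OF q] hom_cod_obj [OF q] hom_cod_obj [OF p]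
  have "\<rho> \<in> Rel R X X" using \<rho> by (simp add: R_equivalence_def)
  then have "Le R X X \<rho> (Ker R p)" using kp le_refl o by simp
  then obtain j where j: "j \<in> hom Y W" "p = j \<bullet> q"
    using quotient_factors [OF Q q p] by blast
  obtain i where i: "i \<in> hom W Y" "q = i \<bullet> p"
    using quotient_factors [OF P p q] \<rho> by blast
  have "(i \<bullet> j) \<bullet> q = ident Y \<bullet> q"
    by (simp only: comp_assoc [OF q j(1) i(1)] j(2) [symmetric] i(2) [symmetric] comp_id_left [OF q])
  then have ij: "i \<bullet> j = ident Y"
    using quotient_arrow_of_epi [OF Q q] comp_hom [OF j(1) i(1)] id_hom o by blast
  have "Le R X X (Ker R q) \<rho>"
    using ker_le_ker_comp [OF q j(1)] j(2) kp by simp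
  then show "\<rho> = Ker R q"
    using le_antisym \<rho> o ker_closed [OF q] by (simp add: R_equivalence_def)
  show "Le R Y Y \<alpha> \<beta>" if \<alpha>: "\<alpha> \<in> Rel R Y Y" and \<beta>: "\<beta> \<in> Rel R Y Y"
    and le: "Le R X X (Reidx R q q \<alpha>) (Reidx R q q \<beta>)"
  proof -
    note i\<alpha> = reidx_closed [OF i(1) i(1) \<alpha>] and i\<beta> = reidx_closed [OF i(1) i(1) \<beta>]
    have r: "Reidx R q q \<gamma> = Reidx R p p (Reidx R i i \<gamma>)" if "\<gamma> \<in> Rel R Y Y" for \<gamma>
      using reidx_comp [OF p i(1) p i(1) that] i(2) by simp
    have r': "Reidx R j j (Reidx R i i \<gamma>) = \<gamma>" if "\<gamma> \<in> Rel R Y Y" for \<gamma>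
      using reidx_comp [OF j(1) i(1) j(1) i(1) that] ij reidx_id o that by simp
    have "Le R W W (Reidx R i i \<alpha>) (Reidx R i i \<beta>)"
      using descent_reflects_le [OF p dp i\<alpha> i\<beta>] le r \<alpha> \<beta> by simp
    then show ?thesis
      using le_reidx [OF j(1) j(1) i\<alpha> i\<beta>] r' \<alpha> \<beta> by simp
  qed
qed

text \<open>A quotient arrow determines the relation it is a quotient of, so the existential quantifier in
  \<open>quotient_arrow\<close> can be removed.\<close>

lemma quotient_arrow_iff:
  assumes q: "q \<in> hom X Y"
  shows "quotient_arrow R q \<longleftrightarrow> quotient_arrow_of R X (Ker R q) q"
proof -
  have "X' = X" if "quotient_arrow_of R X' \<rho> q" for X' \<rho>
    using that hom_dom [OF q] by (simp add: quotient_arrow_of_def)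
  then show ?thesis
    using quotient_arrow_ker_and_reflects(1) [OF _ q] by (metis quotient_arrow_def)
qed

text \<open>If $\mathrm{Ker}(pq) \le \mathrm{Ker}\,f$, then $f = gq$. Since $\mathrm{Ker}(pq)$ and
  $\mathrm{Ker}\,f$ are the reindexings of $\mathrm{Ker}\,p$ and $\mathrm{Ker}\,g$ along $q$, and $q$
  reflects the order, $g$ factors through $p$ in turn.\<close>

lemma quotient_arrow_comp:
  assumes q: "q \<in> hom X Y" and Q: "quotient_arrow R q"
    and p: "p \<in> hom Y Z" and P: "quotient_arrow R p"
  shows "quotient_arrow R (p \<bullet> q)"
proof (rule quotient_arrowI [OF comp_hom [OF q p]])
  have Q': "quotient_arrow_of R X (Ker R q) q" and P': "quotient_arrow_of R Y (Ker R p) p"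
    using Q P quotient_arrow_iff p q by blast+
  note o = hom_dom_obj [OF q]
  fix V f assume f: "f \<in> hom X V" and le: "Le R X X (Ker R (p \<bullet> q)) (Ker R f)"
  have "Le R X X (Ker R q) (Ker R f)"
    using le_trans [OF ker_le_ker_comp [OF q p] le] o ker_closed q f comp_hom [OF q p] by blast
  then obtain g where g: "g \<in> hom Y V" "f = g \<bullet> q"
    using quotient_factors [OF Q' q f] by blast
  have "Le R X X (Reidx R q q (Ker R p)) (Reidx R q q (Ker R g))"
    using le ker_comp [OF q p] ker_comp [OF q g(1)] g(2) by simp
  then have "Le R Y Y (Ker R p) (Ker R g)"
    using quotient_arrow_ker_and_reflects(2) [OF Q' q] ker_closed p g by blast
  then obtain h where "h \<in> hom Z V" "g = h \<bullet> p"
    using quotient_factors [OF P' p g(1)] by blast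
  then show "\<exists>h\<in>hom Z V. f = h \<bullet> p \<bullet> q"
    using g(2) comp_assoc [OF q p] by blast
next
  fix V u v assume uv: "u \<in> hom Z V" "v \<in> hom Z V" "u \<bullet> p \<bullet> q = v \<bullet> p \<bullet> q"
  then have "(u \<bullet> p) \<bullet> q = (v \<bullet> p) \<bullet> q" using comp_assoc [OF q p] by simp
  then have "u \<bullet> p = v \<bullet> p"
    using quotient_arrow_epi [OF Q q] comp_hom [OF p] uv by blast
  then show "u = v" using quotient_arrow_epi [OF P p] uv by blast
qed

text \<open>The factorisation of $g$ through $a$ can only be $g \circ s$. That $g \circ s \circ a = g$ follows
  from extensionality: reindexing $\mathrm{Ker}\,a \le \mathrm{Ker}\,g$ along
  $(s \circ a, \mathrm{id})$ gives $d_A \le \mathrm{Ker}\,a \le R_{gsa,g}(d_Z)$.\<close>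

lemma retraction_quotient_arrow:
  assumes a: "a \<in> hom A X" and s: "s \<in> hom X A" and as: "a \<bullet> s = ident X"
  shows "quotient_arrow R a"
proof (rule quotient_arrowI [OF a _ retraction_epi [OF a s as]])
  fix Z g assume g: "g \<in> hom A Z" and le: "Le R A A (Ker R a) (Ker R g)"
  note o = hom_dom_obj [OF a] hom_cod_obj [OF a] hom_cod_obj [OF g]
  note sa = comp_hom [OF a s] and iA = id_hom [OF o(1)]
  note dX = diag_closed [OF o(2)] and dZ = diag_closed [OF o(3)]
  have asa: "a \<bullet> (s \<bullet> a) = a" using comp_assoc [OF a s a] as comp_id_left [OF a] by simp
  have "Le R A A (Reidx R (s \<bullet> a) (ident A) (Ker R a)) (Reidx R (s \<bullet> a) (ident A) (Ker R g))"
    using le_reidx [OF sa iA] ker_closed a g le by blast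
  then have "Le R A A (Ker R a) (Reidx R (g \<bullet> (s \<bullet> a)) g (Diag R Z))"
    using reidx_comp [OF sa a iA a dX] reidx_comp [OF sa g iA g dZ]
      asa comp_id_right [OF a] comp_id_right [OF g]
    by (simp add: ker_eq_reidx [OF a] ker_eq_reidx [OF g])
  then have "Le R A A (Diag R A) (Reidx R (g \<bullet> (s \<bullet> a)) g (Diag R Z))"
    using le_trans [OF diag_le_ker [OF a]] o diag_closed ker_closed [OF a]
      reidx_closed [OF comp_hom [OF sa g] g dZ] by blast
  then have "g \<bullet> (s \<bullet> a) = g"
    using ext o g comp_hom [OF sa g] by (auto simp: extensional_doctrine_def)
  then show "\<exists>h\<in>hom X Z. g = h \<bullet> a"
    using comp_assoc [OF a s g] comp_hom [OF s g] by (intro bexI [of _ "g \<bullet> s"]) auto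
qed

end


section \<open>Quotients of algebras\<close>

locale quotient_doctrine_monad = extensional_quotient_doctrine R + EQRD_monad R T
  for R :: "('o, 'a, 'r) doctrine" and T :: "('o, 'a, 'r) doctrine_monad"
begin

text \<open>Homomorphisms between $(X,a)$ and $(Y,b)$ are treated as arrows of the base. Their triples in
  the Eilenberg--Moore category are only formed when they are compared with that category.\<close>

abbreviation algebra_hom :: "'o \<Rightarrow> 'a \<Rightarrow> 'o \<Rightarrow> 'a \<Rightarrow> 'a \<Rightarrow> bool" where
  "algebra_hom X a Y b f \<equiv> f \<in> hom X Y \<and> f \<bullet> a = b \<bullet> TArr T f"

lemmas T_obj = cat_functor.map_obj [OF EQRD_1_arrow.hat_functor [OF endo]]
  and T_hom = cat_functor.map_hom [OF EQRD_1_arrow.hat_functor [OF endo]]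
  and T_id = cat_functor.map_id [OF EQRD_1_arrow.hat_functor [OF endo]]
  and T_comp = cat_functor.map_comp [OF EQRD_1_arrow.hat_functor [OF endo]]
  and T_rel = EQRD_1_arrow.bar_closed [OF endo]

text \<open>A 1-arrow commutes with reindexing and preserves diagonals, hence preserves kernels.\<close>

lemma T_ker:
  assumes f: "f \<in> hom X Y"
  shows "TRel T X X (Ker R f) = Ker R (TArr T f)"
  using EQRD_1_arrow.bar_natural [OF endo f f diag_closed] EQRD_1_arrow.bar_diag [OF endo, of Y]
  by (simp add: ker_eq_reidx [OF f] ker_eq_reidx [OF T_hom [OF f]] hom_cod_obj [OF f])

lemma T_quotient_arrow:
  assumes "quotient_arrow R q"
  shows "quotient_arrow R (TArr T q)"
  using assms EQRD_1_arrow.preserves_quotients [OF endo] unfolding quotient_arrow_def by blast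

lemma unit_hom: "X \<in> obj \<Longrightarrow> Unit T X \<in> hom X (TObj T X)"
  and unit_natural: "f \<in> hom X Y \<Longrightarrow> Unit T Y \<bullet> f = TArr T f \<bullet> Unit T X"
  using unit hom_dom_obj [of f X Y] hom_cod_obj [of f X Y]
  by (auto simp: EQRD_2_arrow_def nat_trans_def id_1_arrow_def)

lemma mult_hom: "X \<in> obj \<Longrightarrow> Mult T X \<in> hom (TObj T (TObj T X)) (TObj T X)"
  and mult_natural: "f \<in> hom X Y \<Longrightarrow> Mult T Y \<bullet> TArr T (TArr T f) = TArr T f \<bullet> Mult T X"
  using mult hom_dom_obj [of f X Y] hom_cod_obj [of f X Y]
  by (auto simp: EQRD_2_arrow_def nat_trans_def comp_1_arrow_def)

lemma EM_algebraD:
  assumes "EM_algebra R T (X, a)"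
  shows "X \<in> obj" "a \<in> hom (TObj T X) X" "a \<bullet> Unit T X = ident X"
    "a \<bullet> TArr T a = a \<bullet> Mult T X"
  using assms by (auto simp: EM_algebra_def)

lemma free_EM_algebra: "X \<in> obj \<Longrightarrow> EM_algebra R T (TObj T X, Mult T X)"
  by (simp add: EM_algebra_def T_obj mult_hom unit_left mult_assoc)

lemma structure_algebra_hom:
  assumes "EM_algebra R T (X, a)"
  shows "algebra_hom (TObj T X) (Mult T X) X a a"
  using EM_algebraD [OF assms] by simp

lemma T_algebra_hom:
  assumes f: "f \<in> hom X Y"
  shows "algebra_hom (TObj T X) (Mult T X) (TObj T Y) (Mult T Y) (TArr T f)"
  using T_hom [OF f] mult_natural [OF f] by simp

lemma algebra_hom_comp:
  assumes X: "EM_algebra R T (X, a)" and Y: "EM_algebra R T (Y, b)" and Z: "EM_algebra R T (Z, c)"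
    and f: "algebra_hom X a Y b f" and g: "algebra_hom Y b Z c g"
  shows "algebra_hom X a Z c (g \<bullet> f)"
proof -
  note a = EM_algebraD(2) [OF X] and b = EM_algebraD(2) [OF Y] and c = EM_algebraD(2) [OF Z]
  have fh: "f \<in> hom X Y" and gh: "g \<in> hom Y Z" using f g by auto
  note Tf = T_hom [OF fh] and Tg = T_hom [OF gh]
  have "(g \<bullet> f) \<bullet> a = g \<bullet> b \<bullet> TArr T f"
    using comp_assoc [OF a fh gh] f by simp
  also have "\<dots> = (g \<bullet> b) \<bullet> TArr T f"
    using comp_assoc [OF Tf b gh] by simp
  also have "\<dots> = c \<bullet> TArr T g \<bullet> TArr T f"
    using comp_assoc [OF Tf Tg c] g by simp
  finally show ?thesis using comp_hom [OF fh gh] T_comp [OF fh gh] by simp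
qed

lemma EM_arrow_iff:
  "t \<in> Hom (EM_category R T) (X, a) (Y, b) \<longleftrightarrow>
    EM_algebra R T (X, a) \<and> EM_algebra R T (Y, b) \<and>
    (\<exists>f. algebra_hom X a Y b f \<and> t = ((X, a), f, (Y, b)))"
  by (auto simp: Hom_def EM_category_def)

lemma EM_obj: "Obj (EM_category R T) = {A. EM_algebra R T A}"
  by (simp add: EM_category_def)

lemma EM_base: "Base (EM_doctrine R T) = EM_category R T"
  and EM_le: "Le (EM_doctrine R T) (X, a) (Y, b) = Le R X Y"
  by (simp_all add: EM_doctrine_def)

lemma EM_comp: "(B, g, C) \<cdot>\<^bsub>EM_category R T\<^esub> (A, f, B') = (A, g \<bullet> f, C)"
  by (simp add: EM_category_def)

lemma EM_Rel_iff:
  assumes X: "EM_algebra R T (X, a)" and Y: "EM_algebra R T (Y, b)"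
  shows "\<alpha> \<in> EM_Rel R T (X, a) (Y, b) \<longleftrightarrow>
    \<alpha> \<in> Rel R X Y \<and> Le R (TObj T X) (TObj T Y) (TRel T X Y \<alpha>) (Reidx R a b \<alpha>)"
  using transpose_le_iff_le_reidx [OF EM_algebraD(2) [OF X] EM_algebraD(2) [OF Y] T_rel]
    EM_algebraD(1) [OF X] EM_algebraD(1) [OF Y]
  by (auto simp: EM_Rel_def)

lemma EM_ker:
  assumes "f \<in> hom X Y"
  shows "Ker (EM_doctrine R T) ((X, a), f, (Y, b)) = Ker R f"
  using assms
  by (simp add: Ker_def CoGraph_def Graph_def EM_doctrine_def EM_category_def hom_dom hom_cod)

lemma EM_R_equivalence_iff:
  "R_equivalence (EM_doctrine R T) (X, a) \<rho> \<longleftrightarrow>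
    EM_algebra R T (X, a) \<and> \<rho> \<in> EM_Rel R T (X, a) (X, a) \<and> R_equivalence R X \<rho>"
  by (auto simp: R_equivalence_def EM_doctrine_def EM_obj EM_Rel_def dest: EM_algebraD(1))

text \<open>Source, target and order of the fibres are spelled out once here, so that the arguments below can
  use the universal property without projecting from triples.\<close>

lemma EM_quotient_arrow_of_iff:
  assumes t: "t \<in> Hom (EM_category R T) (X, a) (Y, b)"
  shows "quotient_arrow_of (EM_doctrine R T) (X, a) \<rho> t \<longleftrightarrow>
    R_equivalence (EM_doctrine R T) (X, a) \<rho> \<and> Le R X X \<rho> (Ker (EM_doctrine R T) t) \<and>
    (\<forall>Z c. \<forall>f\<in>Hom (EM_category R T) (X, a) (Z, c). Le R X X \<rho> (Ker (EM_doctrine R T) f) \<longrightarrow>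
      (\<exists>!h. h \<in> Hom (EM_category R T) (Y, b) (Z, c) \<and> f = h \<cdot>\<^bsub>EM_category R T\<^esub> t))"
proof -
  let ?E = "EM_category R T"
  have "t \<in> Arr ?E" "Dom ?E t = (X, a)" "Cod ?E t = (Y, b)"
    using t by (simp_all add: Hom_def)
  moreover have "(\<forall>Z\<in>Obj ?E. \<forall>f\<in>Hom ?E (X, a) Z. P Z f) \<longleftrightarrow>
      (\<forall>Z c. \<forall>f\<in>Hom ?E (X, a) (Z, c). P (Z, c) f)" for P
  proof -
    have "(Z, c) \<in> Obj ?E" if "f \<in> Hom ?E (X, a) (Z, c)" for Z c f
      using that by (simp add: EM_arrow_iff EM_obj)
    then show ?thesis by (metis surj_pair)
  qed
  ultimately show ?thesis
    unfolding quotient_arrow_of_def EM_base EM_le by simp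
qed

text \<open>$\overline T(\mathrm{Ker}\,f) = \mathrm{Ker}(Tf) \le \mathrm{Ker}(b \circ Tf) =
  \mathrm{Ker}(f \circ a) = R_{a,a}(\mathrm{Ker}\,f)$.\<close>

lemma ker_mem_EM_Rel:
  assumes X: "EM_algebra R T (X, a)" and Y: "EM_algebra R T (Y, b)" and f: "algebra_hom X a Y b f"
  shows "Ker R f \<in> EM_Rel R T (X, a) (X, a)"
proof -
  have fh: "f \<in> hom X Y" using f by simp
  note a = EM_algebraD(2) [OF X] and b = EM_algebraD(2) [OF Y]
  have "Le R (TObj T X) (TObj T X) (Ker R (TArr T f)) (Ker R (b \<bullet> TArr T f))"
    using ker_le_ker_comp [OF T_hom [OF fh] b] .
  then have "Le R (TObj T X) (TObj T X) (TRel T X X (Ker R f)) (Reidx R a a (Ker R f))"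
    using f ker_comp [OF a fh] T_ker [OF fh] by simp
  then show ?thesis using EM_Rel_iff [OF X X] ker_closed [OF fh] by simp
qed

text \<open>The hypothesis on $\mathrm{Ker}\,q$ says $\mathrm{Ker}(Tq) \le \mathrm{Ker}(q \circ a)$, so
  $q \circ a$ factors as $w \circ Tq$. The unit law of $w$ is checked after composing with $q$ and the
  associative law after composing with $TTq$; both can be cancelled.\<close>

lemma quotient_algebra:
  assumes X: "EM_algebra R T (X, a)" and \<rho>: "Ker R q \<in> EM_Rel R T (X, a) (X, a)"
    and q: "q \<in> hom X W" and Q: "quotient_arrow R q"
  obtains w where "EM_algebra R T (W, w)" "algebra_hom X a W w q"
proof -
  note a = EM_algebraD(2) [OF X] and Tq = T_hom [OF q]
  note TTq = T_hom [OF Tq]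
  note o = hom_dom_obj [OF q] hom_cod_obj [OF q]
  note TQ = T_quotient_arrow [OF Q]
  note TTQ = T_quotient_arrow [OF TQ]
  have "Le R (TObj T X) (TObj T X) (Ker R (TArr T q)) (Ker R (q \<bullet> a))"
    using \<rho> EM_Rel_iff [OF X X] T_ker [OF q] ker_comp [OF a q] by simp
  then obtain w where w: "w \<in> hom (TObj T W) W" and wq: "q \<bullet> a = w \<bullet> TArr T q"
    using quotient_factors [OF iffD1 [OF quotient_arrow_iff [OF Tq] TQ] Tq comp_hom [OF a q]]
    by blast
  note Tw = T_hom [OF w] and Ta = T_hom [OF a]
  note \<eta>X = unit_hom [OF o(1)] and \<eta>W = unit_hom [OF o(2)]
  note \<mu>X = mult_hom [OF o(1)] and \<mu>W = mult_hom [OF o(2)]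
  have "(w \<bullet> Unit T W) \<bullet> q = w \<bullet> TArr T q \<bullet> Unit T X"
    using comp_assoc [OF q \<eta>W w] unit_natural [OF q] by simp
  also have "\<dots> = (q \<bullet> a) \<bullet> Unit T X"
    using comp_assoc [OF \<eta>X Tq w] wq by simp
  also have "\<dots> = ident W \<bullet> q"
    using comp_assoc [OF \<eta>X a q] EM_algebraD(3) [OF X] comp_id_right [OF q] comp_id_left [OF q]
    by simp
  finally have unit_law: "w \<bullet> Unit T W = ident W"
    by (rule quotient_arrow_epi [OF Q q comp_hom [OF \<eta>W w] id_hom [OF o(2)]])
  have "(w \<bullet> TArr T w) \<bullet> TArr T (TArr T q) = w \<bullet> TArr T w \<bullet> TArr T (TArr T q)"
    by (rule comp_assoc [OF TTq Tw w])
  also have "\<dots> = w \<bullet> TArr T q \<bullet> TArr T a"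
    using T_comp [OF Tq w] T_comp [OF a q] wq by simp
  also have "\<dots> = (q \<bullet> a) \<bullet> TArr T a"
    using comp_assoc [OF Ta Tq w] wq by simp
  also have "\<dots> = q \<bullet> a \<bullet> Mult T X"
    using comp_assoc [OF Ta a q] EM_algebraD(4) [OF X] by simp
  also have "\<dots> = (w \<bullet> TArr T q) \<bullet> Mult T X"
    using comp_assoc [OF \<mu>X a q] wq by simp
  also have "\<dots> = w \<bullet> Mult T W \<bullet> TArr T (TArr T q)"
    using comp_assoc [OF \<mu>X Tq w] mult_natural [OF q] by simp
  also have "\<dots> = (w \<bullet> Mult T W) \<bullet> TArr T (TArr T q)"
    by (rule comp_assoc [OF TTq \<mu>W w, symmetric])
  finally have "w \<bullet> TArr T w = w \<bullet> Mult T W"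
    by (rule quotient_arrow_epi [OF TTQ TTq comp_hom [OF Tw w] comp_hom [OF \<mu>W w]])
  then have "EM_algebra R T (W, w)"
    using unit_law w o by (simp add: EM_algebra_def)
  then show thesis using that q wq by simp
qed

text \<open>The two sides of the equation for $h$ agree after composing with $Tq$, which can be cancelled.\<close>

lemma algebra_hom_descends:
  assumes X: "EM_algebra R T (X, a)" and Y: "EM_algebra R T (Y, b)" and Z: "EM_algebra R T (Z, c)"
    and q: "algebra_hom X a Y b q" and Q: "quotient_arrow R q"
    and h: "h \<in> hom Y Z" and hq: "algebra_hom X a Z c (h \<bullet> q)"
  shows "algebra_hom Y b Z c h"
proof -
  have qh: "q \<in> hom X Y" using q by simp
  note a = EM_algebraD(2) [OF X] and b = EM_algebraD(2) [OF Y] and c = EM_algebraD(2) [OF Z]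
  note Tq = T_hom [OF qh] and Th = T_hom [OF h]
  have "(h \<bullet> b) \<bullet> TArr T q = h \<bullet> q \<bullet> a"
    using comp_assoc [OF Tq b h] q by simp
  also have "\<dots> = c \<bullet> TArr T (h \<bullet> q)"
    using comp_assoc [OF a qh h] hq by simp
  also have "\<dots> = (c \<bullet> TArr T h) \<bullet> TArr T q"
    using comp_assoc [OF Tq Th c] T_comp [OF qh h] by simp
  finally have "h \<bullet> b = c \<bullet> TArr T h"
    by (rule quotient_arrow_epi [OF T_quotient_arrow [OF Q] Tq comp_hom [OF b h] comp_hom [OF Th c]])
  then show ?thesis using h by simp
qed

text \<open>The factorisation in the base is the only candidate, and it is a homomorphism by
  \<open>algebra_hom_descends\<close>.\<close>

lemma EM_quotient_arrow_ofI:
  assumes X: "EM_algebra R T (X, a)" and Y: "EM_algebra R T (Y, b)"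
    and q: "algebra_hom X a Y b q" and Q: "quotient_arrow R q"
  shows "quotient_arrow_of (EM_doctrine R T) (X, a) (Ker R q) ((X, a), q, (Y, b))"
proof -
  have qh: "q \<in> hom X Y" using q by simp
  note Q' = iffD1 [OF quotient_arrow_iff [OF qh] Q]
  let ?t = "((X, a), q, (Y, b))"
  have eq: "R_equivalence (EM_doctrine R T) (X, a) (Ker R q)"
    using EM_R_equivalence_iff X ker_mem_EM_Rel [OF X Y q] ker_R_equivalence [OF qh] by blast
  have fac: "\<exists>!u. u \<in> Hom (EM_category R T) (Y, b) (Z, c) \<and> t = u \<cdot>\<^bsub>EM_category R T\<^esub> ?t"
    if t: "t \<in> Hom (EM_category R T) (X, a) (Z, c)"
      and le: "Le R X X (Ker R q) (Ker (EM_doctrine R T) t)" for Z c t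
  proof -
    obtain f where Z: "EM_algebra R T (Z, c)" and f: "algebra_hom X a Z c f"
      and tf: "t = ((X, a), f, (Z, c))"
      using t EM_arrow_iff by auto
    have fh: "f \<in> hom X Z" using f by simp
    have "Le R X X (Ker R q) (Ker R f)" using le tf EM_ker [OF fh] by simp
    then obtain h where h: "h \<in> hom Y Z" "f = h \<bullet> q"
      and uniq: "\<And>h'. h' \<in> hom Y Z \<Longrightarrow> f = h' \<bullet> q \<Longrightarrow> h' = h"
      using quotient_factors [OF Q' qh fh] by blast
    have "algebra_hom Y b Z c h"
      using algebra_hom_descends [OF X Y Z q Q h(1)] f h(2) by simp
    then have "((Y, b), h, (Z, c)) \<in> Hom (EM_category R T) (Y, b) (Z, c)"
      using Y Z EM_arrow_iff by auto
    moreover have "t = ((Y, b), h, (Z, c)) \<cdot>\<^bsub>EM_category R T\<^esub> ?t"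
      using EM_comp h(2) tf by simp
    moreover have "u = ((Y, b), h, (Z, c))"
      if "u \<in> Hom (EM_category R T) (Y, b) (Z, c)" "t = u \<cdot>\<^bsub>EM_category R T\<^esub> ?t" for u
      using that uniq EM_arrow_iff EM_comp tf by auto
    ultimately show ?thesis by blast
  qed
  have "?t \<in> Hom (EM_category R T) (X, a) (Y, b)" using X Y q EM_arrow_iff by auto
  moreover have "Le R X X (Ker R q) (Ker (EM_doctrine R T) ?t)"
    using EM_ker [OF qh] le_refl ker_closed qh hom_dom_obj by simp
  ultimately show ?thesis
    using eq fac EM_quotient_arrow_of_iff by blast
qed

text \<open>For the direction from algebras to the base, let $q$ be a quotient of $\rho$ among algebras and let
  $p$ be the effective quotient of $\rho$ in the base, made into a homomorphism by
  \<open>quotient_algebra\<close>. The two universal properties give $q = i \circ p$ and $p = j \circ q$, and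
  uniqueness among algebras gives $i \circ j = \mathrm{id}$. So $i$ is a retraction, and $q$ is a
  composite of two quotient arrows.\<close>

lemma EM_quotient_arrow_iff:
  assumes X: "EM_algebra R T (X, a)" and Y: "EM_algebra R T (Y, b)" and q: "algebra_hom X a Y b q"
  shows "quotient_arrow (EM_doctrine R T) ((X, a), q, (Y, b)) \<longleftrightarrow> quotient_arrow R q"
proof
  assume "quotient_arrow R q"
  then show "quotient_arrow (EM_doctrine R T) ((X, a), q, (Y, b))"
    using EM_quotient_arrow_ofI [OF X Y q] by (auto simp: quotient_arrow_def)
next
  let ?E = "EM_category R T" and ?t = "((X, a), q, (Y, b))"
  have qh: "q \<in> hom X Y" using q by simp
  note o = hom_dom_obj [OF qh] hom_cod_obj [OF qh]
  have t: "?t \<in> Hom ?E (X, a) (Y, b)" using X Y q EM_arrow_iff by auto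
  assume "quotient_arrow (EM_doctrine R T) ?t"
  then obtain \<rho> where "quotient_arrow_of (EM_doctrine R T) (X, a) \<rho> ?t"
    using t by (auto simp: quotient_arrow_def quotient_arrow_of_def EM_base Hom_def)
  then have \<rho>: "R_equivalence (EM_doctrine R T) (X, a) \<rho>"
    and le: "Le R X X \<rho> (Ker (EM_doctrine R T) ?t)"
    and fac: "\<And>Z c f. f \<in> Hom ?E (X, a) (Z, c) \<Longrightarrow> Le R X X \<rho> (Ker (EM_doctrine R T) f) \<Longrightarrow>
      \<exists>!h. h \<in> Hom ?E (Y, b) (Z, c) \<and> f = h \<cdot>\<^bsub>?E\<^esub> ?t"
    unfolding EM_quotient_arrow_of_iff [OF t] by blast+
  have \<rho>R: "R_equivalence R X \<rho>" and \<rho>E: "\<rho> \<in> EM_Rel R T (X, a) (X, a)"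
    using \<rho> EM_R_equivalence_iff by blast+
  obtain p W where p: "p \<in> hom X W" and P: "quotient_arrow_of R X \<rho> p" and kp: "Ker R p = \<rho>"
    using effective_descent_quotient [OF \<rho>R] .
  have PQ: "quotient_arrow R p" using P by (auto simp: quotient_arrow_def)
  obtain w where W: "EM_algebra R T (W, w)" and pw: "algebra_hom X a W w p"
    using quotient_algebra [OF X _ p PQ] \<rho>E kp by blast
  obtain i where i: "i \<in> hom W Y" and qi: "q = i \<bullet> p"
    using quotient_factors [OF P p qh] le EM_ker [OF qh] by auto
  have ia: "algebra_hom W w Y b i"
    using algebra_hom_descends [OF X W Y pw PQ i] q qi by simp
  have "((X, a), p, (W, w)) \<in> Hom ?E (X, a) (W, w)" using X W pw EM_arrow_iff by auto
  moreover have "Le R X X \<rho> (Ker (EM_doctrine R T) ((X, a), p, (W, w)))"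
    using EM_ker [OF p] kp le_refl o ker_closed [OF p] by simp
  ultimately obtain u where "u \<in> Hom ?E (Y, b) (W, w)" "((X, a), p, (W, w)) = u \<cdot>\<^bsub>?E\<^esub> ?t"
    using fac by blast
  then obtain j where j: "algebra_hom Y b W w j" and pj: "p = j \<bullet> q"
    using EM_arrow_iff EM_comp by auto
  have jh: "j \<in> hom Y W" using j by simp
  have "algebra_hom Y b Y b (i \<bullet> j)"
    using algebra_hom_comp [OF Y W Y j ia] .
  then have "((Y, b), i \<bullet> j, (Y, b)) \<in> Hom ?E (Y, b) (Y, b)"
    using Y EM_arrow_iff by auto
  moreover have "?t = ((Y, b), i \<bullet> j, (Y, b)) \<cdot>\<^bsub>?E\<^esub> ?t"
    using EM_comp comp_assoc [OF qh jh i] pj [symmetric] qi [symmetric] by simp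
  moreover have "algebra_hom Y b Y b (ident Y)"
    using T_id o comp_id_left EM_algebraD(2) [OF Y] comp_id_right id_hom by simp
  then have "((Y, b), ident Y, (Y, b)) \<in> Hom ?E (Y, b) (Y, b)"
    using Y EM_arrow_iff by auto
  moreover have "?t = ((Y, b), ident Y, (Y, b)) \<cdot>\<^bsub>?E\<^esub> ?t"
    using EM_comp comp_id_left [OF qh] by simp
  ultimately have "((Y, b), i \<bullet> j, (Y, b)) = ((Y, b), ident Y, (Y, b))"
    using fac [OF t le] by blast
  then have "quotient_arrow R i"
    using retraction_quotient_arrow [OF i jh] by simp
  then show "quotient_arrow R q"
    using quotient_arrow_comp [OF p PQ i] qi by simp
qed


section \<open>Projective algebras\<close>

text \<open>A lift $k$ of $f \circ \eta_P$ along the quotient arrow $q$ extends to the homomorphism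
  $a \circ Tk$, and $q \circ a \circ Tk = b \circ T(f \circ \eta_P) = f \circ \mu_P \circ T\eta_P = f$.\<close>

lemma free_algebra_projective:
  assumes P: "R_projective R P"
  shows "R_projective (EM_doctrine R T) (TObj T P, Mult T P)"
proof -
  let ?E = "EM_category R T"
  have o: "P \<in> obj" using P by (simp add: R_projective_def)
  note F = free_EM_algebra [OF o]
  note \<eta> = unit_hom [OF o] and \<mu> = mult_hom [OF o]
  have "\<exists>h\<in>Hom ?E (TObj T P, Mult T P) (X, a). t = s \<cdot>\<^bsub>?E\<^esub> h"
    if t: "t \<in> Hom ?E (TObj T P, Mult T P) (Y, b)" and s: "s \<in> Hom ?E (X, a) (Y, b)"
      and S: "quotient_arrow (EM_doctrine R T) s" for X a Y b t s
  proof -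
    obtain f where Y: "EM_algebra R T (Y, b)" and f: "algebra_hom (TObj T P) (Mult T P) Y b f"
      and tf: "t = ((TObj T P, Mult T P), f, (Y, b))"
      using t EM_arrow_iff by auto
    obtain q where X: "EM_algebra R T (X, a)" and q: "algebra_hom X a Y b q"
      and sq: "s = ((X, a), q, (Y, b))"
      using s EM_arrow_iff by auto
    have fh: "f \<in> hom (TObj T P) Y" and qh: "q \<in> hom X Y" using f q by auto
    note a = EM_algebraD(2) [OF X] and b = EM_algebraD(2) [OF Y]
    have "quotient_arrow R q" using S sq EM_quotient_arrow_iff [OF X Y q] by simp
    then obtain k where k: "k \<in> hom P X" and fk: "f \<bullet> Unit T P = q \<bullet> k"
      using P comp_hom [OF \<eta> fh] qh hom_dom_obj [OF qh] hom_cod_obj [OF qh]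
      unfolding R_projective_def by blast
    note T\<eta> = T_hom [OF \<eta>] and Tf = T_hom [OF fh] and Tk = T_hom [OF k] and Tq = T_hom [OF qh]
    have ak: "algebra_hom (TObj T P) (Mult T P) X a (a \<bullet> TArr T k)"
      using algebra_hom_comp [OF F free_EM_algebra X T_algebra_hom [OF k] structure_algebra_hom [OF X]]
        EM_algebraD(1) [OF X] by simp
    have "q \<bullet> a \<bullet> TArr T k = (b \<bullet> TArr T q) \<bullet> TArr T k"
      using comp_assoc [OF Tk a qh] q by simp
    also have "\<dots> = b \<bullet> TArr T f \<bullet> TArr T (Unit T P)"
      using comp_assoc [OF Tk Tq b] T_comp [OF k qh] T_comp [OF \<eta> fh] fk by simp
    also have "\<dots> = (f \<bullet> Mult T P) \<bullet> TArr T (Unit T P)"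
      using comp_assoc [OF T\<eta> Tf b] f by simp
    also have "\<dots> = f"
      using comp_assoc [OF T\<eta> \<mu> fh] unit_right [OF o] comp_id_right [OF fh] by simp
    finally have "t = s \<cdot>\<^bsub>?E\<^esub> ((TObj T P, Mult T P), a \<bullet> TArr T k, (X, a))"
      using EM_comp tf sq by simp
    moreover have "((TObj T P, Mult T P), a \<bullet> TArr T k, (X, a)) \<in> Hom ?E (TObj T P, Mult T P) (X, a)"
      using F X ak EM_arrow_iff by auto
    ultimately show ?thesis by blast
  qed
  then show ?thesis
    using F unfolding R_projective_def EM_base Ball_def split_paired_All EM_obj by blast
qed

text \<open>$Tq$ is a quotient arrow because $T$ preserves them, and the structure map $a$ is one because
  $\eta_X$ is a section of it.\<close>

lemma free_algebra_covers:
  assumes X: "EM_algebra R T (X, a)" and q: "q \<in> hom P X" and Q: "quotient_arrow R q"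
  shows "((TObj T P, Mult T P), a \<bullet> TArr T q, (X, a)) \<in>
      Hom (EM_category R T) (TObj T P, Mult T P) (X, a)"
    and "quotient_arrow (EM_doctrine R T) ((TObj T P, Mult T P), a \<bullet> TArr T q, (X, a))"
proof -
  note aX = EM_algebraD [OF X]
  note F = free_EM_algebra [OF hom_dom_obj [OF q]]
  have h: "algebra_hom (TObj T P) (Mult T P) X a (a \<bullet> TArr T q)"
    using algebra_hom_comp [OF F free_EM_algebra [OF aX(1)] X T_algebra_hom [OF q]
        structure_algebra_hom [OF X]] .
  have "quotient_arrow R a"
    using retraction_quotient_arrow [OF aX(2) unit_hom [OF aX(1)] aX(3)] .
  then have "quotient_arrow R (a \<bullet> TArr T q)"
    using quotient_arrow_comp [OF T_hom [OF q] T_quotient_arrow [OF Q] aX(2)] by simp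
  then show "quotient_arrow (EM_doctrine R T) ((TObj T P, Mult T P), a \<bullet> TArr T q, (X, a))"
    using EM_quotient_arrow_iff [OF F X h] by simp
  show "((TObj T P, Mult T P), a \<bullet> TArr T q, (X, a)) \<in>
      Hom (EM_category R T) (TObj T P, Mult T P) (X, a)"
    using EM_arrow_iff F X h by auto
qed

lemma full_subcategory_free_algebras:
  assumes "Obj G \<subseteq> obj"
  shows "full_subcategory (free_algebras R T G) (EM_category R T)"
  using assms free_EM_algebra
  by (auto simp: full_subcategory_def free_algebras_def full_subcategory_on_def EM_obj)

lemma projective_cover_free_algebras:
  assumes G: "R_projective_cover R G"
  shows "R_projective_cover (EM_doctrine R T) (free_algebras R T G)"
proof -
  have sub: "Obj G \<subseteq> obj"
    using G by (simp add: R_projective_cover_def full_subcategory_def)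
  have obj_free: "Obj (free_algebras R T G) = {(TObj T X, Mult T X) | X. X \<in> Obj G}"
    by (simp add: free_algebras_def full_subcategory_on_def)
  have "\<exists>F\<in>Obj (free_algebras R T G). \<exists>t\<in>Hom (EM_category R T) F (X, a).
      quotient_arrow (EM_doctrine R T) t" if X: "EM_algebra R T (X, a)" for X a
  proof -
    obtain P q where "P \<in> Obj G" "q \<in> hom P X" "quotient_arrow R q"
      using G EM_algebraD(1) [OF X] by (auto simp: R_projective_cover_def)
    then show ?thesis using free_algebra_covers [OF X] obj_free by blast
  qed
  then show ?thesis
    using G full_subcategory_free_algebras [OF sub] free_algebra_projective
    by (auto simp: R_projective_cover_def EM_base obj_free EM_obj)
qed

end


section \<open>The identity monad\<close>

definition id_monad :: "('o, 'a, 'r) doctrine \<Rightarrow> ('o, 'a, 'r) doctrine_monad" where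
  "id_monad R = \<lparr>Endo = id_1_arrow, Unit = Id (Base R), Mult = Id (Base R)\<rparr>"

lemma comp_id_1_arrow: "comp_1_arrow id_1_arrow id_1_arrow = id_1_arrow"
  by (simp add: comp_1_arrow_def id_1_arrow_def)

context extensional_quotient_doctrine
begin

lemma id_1_arrow: "EQRD_1_arrow R R id_1_arrow"
proof -
  have "EQRD_object R"
    using relational_doctrine_axioms ext quots by (simp add: EQRD_object_def)
  moreover have "cat_functor (Base R) (Base R) (Hat id_1_arrow)"
    by (rule cat_functor.intro) (simp_all add: base id_1_arrow_def)
  ultimately show ?thesis
    by (intro EQRD_1_arrow.intro) (simp_all add: id_1_arrow_def monotone_on_def)
qed

lemma id_monad: "EQRD_monad R (id_monad R)"
proof -
  have "EQRD_2_arrow R R id_1_arrow id_1_arrow ident"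
    using id_1_arrow
    by (auto simp: EQRD_2_arrow_def nat_trans_def id_1_arrow_def id_hom comp_id_left comp_id_right
        reidx_id le_refl)
  then show ?thesis
    using id_1_arrow
    by (intro EQRD_monad.intro)
      (simp_all add: id_monad_def comp_id_1_arrow comp_id_left [OF id_hom],
        simp_all add: id_1_arrow_def comp_id_left [OF id_hom])
qed

interpretation I: quotient_doctrine_monad R "id_monad R"
  by (intro quotient_doctrine_monad.intro extensional_quotient_doctrine_axioms id_monad)

lemma id_monad_simps:
  "TObj (id_monad R) X = X" "TArr (id_monad R) f = f" "Mult (id_monad R) X = ident X"
  "Unit (id_monad R) X = ident X"
  by (simp_all add: id_monad_def id_1_arrow_def)

lemma id_monad_algebra_iff:
  "EM_algebra R (id_monad R) (X, a) \<longleftrightarrow> X \<in> obj \<and> a = ident X"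
proof
  assume A: "EM_algebra R (id_monad R) (X, a)"
  then have "a \<in> hom X X" "a \<bullet> ident X = ident X"
    using I.EM_algebraD(2,3) by (simp_all add: id_monad_simps)
  then show "X \<in> obj \<and> a = ident X"
    using I.EM_algebraD(1) [OF A] comp_id_right by simp
next
  assume "X \<in> obj \<and> a = ident X"
  then show "EM_algebra R (id_monad R) (X, a)"
    using I.free_EM_algebra by (auto simp: id_monad_simps)
qed

lemma id_monad_arrow_iff:
  "t \<in> Hom (EM_category R (id_monad R)) (X, ident X) (Y, ident Y) \<longleftrightarrow>
    (\<exists>f\<in>hom X Y. t = ((X, ident X), f, (Y, ident Y)))"
  using hom_dom_obj [of _ X Y] hom_cod_obj [of _ X Y] comp_id_left [of _ X Y] comp_id_right [of _ X Y]
  by (auto simp: I.EM_arrow_iff id_monad_algebra_iff id_monad_simps)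

lemma id_monad_quotient_arrow_iff:
  assumes "q \<in> hom X Y"
  shows "quotient_arrow (EM_doctrine R (id_monad R)) ((X, ident X), q, (Y, ident Y)) \<longleftrightarrow>
    quotient_arrow R q"
  using assms hom_dom_obj hom_cod_obj comp_id_left comp_id_right
  by (intro I.EM_quotient_arrow_iff) (auto simp: id_monad_algebra_iff id_monad_simps)

lemma projective_if_id_monad_projective:
  assumes P: "R_projective (EM_doctrine R (id_monad R)) (P, ident P)"
  shows "R_projective R P"
proof -
  let ?E = "EM_category R (id_monad R)"
  have "P \<in> obj"
    using P by (simp add: R_projective_def I.EM_base I.EM_obj id_monad_algebra_iff)
  moreover have "\<exists>h\<in>hom P X. f = q \<bullet> h"
    if f: "f \<in> hom P Y" and q: "q \<in> hom X Y" and Q: "quotient_arrow R q" for X Y f q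
  proof -
    let ?t = "((P, ident P), f, (Y, ident Y))" and ?s = "((X, ident X), q, (Y, ident Y))"
    have "(X, ident X) \<in> Obj ?E" "(Y, ident Y) \<in> Obj ?E"
      using hom_dom_obj [OF q] hom_cod_obj [OF q] by (simp_all add: I.EM_obj id_monad_algebra_iff)
    moreover have "?t \<in> Hom ?E (P, ident P) (Y, ident Y)" "?s \<in> Hom ?E (X, ident X) (Y, ident Y)"
      using f q by (auto simp: id_monad_arrow_iff)
    moreover have "quotient_arrow (EM_doctrine R (id_monad R)) ?s"
      using id_monad_quotient_arrow_iff [OF q] Q by simp
    ultimately obtain u where "u \<in> Hom ?E (P, ident P) (X, ident X)" "?t = ?s \<cdot>\<^bsub>?E\<^esub> u"
      using P unfolding R_projective_def I.EM_base by blast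
    then show ?thesis by (auto simp: id_monad_arrow_iff I.EM_comp)
  qed
  ultimately show ?thesis unfolding R_projective_def by blast
qed

text \<open>The free algebra of the identity monad on $X$ is $(X,\mathrm{id}_X)$, and every algebra is of this
  form, so lifts and covers transfer to the base arrow by arrow.\<close>

lemma projective_cover_if_id_monad_projective_cover:
  assumes G: "full_subcategory G (Base R)"
    and cover: "R_projective_cover (EM_doctrine R (id_monad R)) (free_algebras R (id_monad R) G)"
  shows "R_projective_cover R G"
proof -
  let ?E = "EM_category R (id_monad R)"
  have obj_free: "Obj (free_algebras R (id_monad R) G) = {(X, ident X) | X. X \<in> Obj G}"
    by (simp add: free_algebras_def full_subcategory_on_def id_monad_simps)
  have "R_projective R P" if "P \<in> Obj G" for P
    using cover that projective_if_id_monad_projective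
    unfolding R_projective_cover_def obj_free by blast
  moreover have "\<exists>P\<in>Obj G. \<exists>q\<in>hom P X. quotient_arrow R q" if "X \<in> obj" for X
  proof -
    have "(X, ident X) \<in> Obj ?E"
      using that by (simp add: I.EM_obj id_monad_algebra_iff)
    then obtain P t where P: "P \<in> Obj G" and t: "t \<in> Hom ?E (P, ident P) (X, ident X)"
      and Q: "quotient_arrow (EM_doctrine R (id_monad R)) t"
      using cover unfolding R_projective_cover_def obj_free I.EM_base by blast
    then obtain q where q: "q \<in> hom P X" "t = ((P, ident P), q, (X, ident X))"
      using id_monad_arrow_iff by blast
    then show ?thesis using P Q id_monad_quotient_arrow_iff by blast
  qed
  ultimately show ?thesis using G unfolding R_projective_cover_def by blast
qed

end

theorem theorem6p11:
  fixes R :: "('o, 'a, 'r) doctrine" and G :: "('o, 'a) cat"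
  assumes "relational_doctrine R" and "extensional_doctrine R" and "has_quotients R"
    and "full_subcategory G (Base R)"
  shows "R_projective_cover R G \<longleftrightarrow>
    (\<forall>T. EQRD_monad R T \<longrightarrow> R_projective_cover (EM_doctrine R T) (free_algebras R T G))"
proof -
  interpret extensional_quotient_doctrine R
    using assms(1-3)
    by (simp add: extensional_quotient_doctrine.intro extensional_quotient_doctrine_axioms.intro)
  show ?thesis
    using quotient_doctrine_monad.projective_cover_free_algebras id_monad
      quotient_doctrine_monad.intro [OF extensional_quotient_doctrine_axioms]
      projective_cover_if_id_monad_projective_cover [OF assms(4)] by blast
qed

end
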